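(* Let $n\ge 2$ and $s\in(0,\tfrac12)$. Let $K\subset\mathbb{R}^n$ be a compact convex set which is smooth (of class at least $C^{0,1}$). Let $f\in C^1([0,1])$ be such that there exists $\theta\in(0,1)$ with $$f(0)=f(\theta)=f(1)=0,\quad f<0 \text{ in }(0,\theta),\quad f>0\text{ in }(\theta,1),$$ $$\int_0^1 f(t)\,dt>0,\quad f'(0)<0,\quad f'(\theta)>0,\quad f'(1)<0.$$ Let $\beta>2s$ and let $u\in C^{0,\beta}(\mathbb{R}^n\setminus K,[0,1])$ satisfy $$\mathcal{L}[u](x)+f(u(x))\le 0\quad\text{for all }x\in\mathbb{R}^n\setminus K,\qquad u(x)\to 1\ \text{ as }|x|\to+\infty,$$ where $\mathcal{L}$ is the regional $s$-fractional Laplacian on $\mathbb{R}^n\setminus K$. Then $u=1$ in $\overline{\mathbb{R}^n\setminus K}$.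
   Context: The regional fractional Laplacian on $\mathbb{R}^n\setminus K$ is defined, for $s\in(0,1)$, by $$\mathcal{L}[u](x):=C_{n,s}\lim_{\epsilon\to0^+}\int_{\{y\in\mathbb{R}^n\setminus K,\ |x-y|>\epsilon\}}\frac{u(y)-u(x)}{|x-y|^{n+2s}}\,dy,$$ where $C_{n,s}>0$ is the usual normalization constant of the fractional Laplacian. "Smooth (of class at least $C^{0,1}$)" means that the boundary of $K$ has at least Lipschitz regularity. $C^{0,\beta}(\mathbb{R}^n\setminus K,[0,1])$ is the set of $[0,1]$-valued functions on $\mathbb{R}^n\setminus K$ that are (uniformly) Hölder continuous with exponent $\beta$; such a $u$ is identified with its continuous extension to the closure $\overline{\mathbb{R}^n\setminus K}$. *)

theory Defs
  imports "HOL-Analysis.Analysis"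
begin

(* 2^(2s) s Gamma(n/2 + s) / (pi^(n/2) Gamma(1 - s)): the constant for which the Fourier symbol
   of the full-space operator is -|xi|^(2s). *)
definition frac_laplacian_const :: "nat \<Rightarrow> real \<Rightarrow> real" where
  "frac_laplacian_const n s =
     2 powr (2 * s) * s * Gamma (real n / 2 + s) / (pi powr (real n / 2) * Gamma (1 - s))"

(* Principal value. Lim is an arbitrary value if the limit does not exist; for x in the open set -K
   it does exist as soon as u is bounded and Hoelder continuous on -K with exponent > 2s. *)
definition regional_frac_laplacian ::
    "real \<Rightarrow> (real ^ 'n) set \<Rightarrow> (real ^ 'n \<Rightarrow> real) \<Rightarrow> real ^ 'n \<Rightarrow> real" where
  "regional_frac_laplacian s K u x =
     frac_laplacian_const CARD('n) s *
     Lim (at_right 0) (\<lambda>\<epsilon>.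
       LINT y : {y. y \<notin> K \<and> dist x y > \<epsilon>} | lborel.
         (u y - u x) / dist x y powr (real CARD('n) + 2 * s))"

definition holder_on :: "real \<Rightarrow> 'a::metric_space set \<Rightarrow> ('a \<Rightarrow> real) \<Rightarrow> bool" where
  "holder_on \<beta> S u \<longleftrightarrow> (\<exists>M. \<forall>x\<in>S. \<forall>y\<in>S. \<bar>u x - u y\<bar> \<le> M * dist x y powr \<beta>)"

(* Near each boundary point, K is the closed epigraph, in the direction of a unit vector \<nu>, of a
   Lipschitz function g on the hyperplane orthogonal to \<nu>; choosing \<nu> and identifying that
   hyperplane with R^(n-1) amounts to choosing rotated Cartesian coordinates. *)
definition lipschitz_boundary :: "'a::euclidean_space set \<Rightarrow> bool" where
  "lipschitz_boundary K \<longleftrightarrow>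
     (\<forall>p\<in>frontier K. \<exists>r>0. \<exists>\<nu> g L. norm \<nu> = 1 \<and> L-lipschitz_on {z. z \<bullet> \<nu> = 0} g \<and>
        (\<forall>x\<in>ball p r. x \<in> K \<longleftrightarrow> g (x - (x \<bullet> \<nu>) *\<^sub>R \<nu>) \<le> x \<bullet> \<nu>))"

(* Extension of u from S to the closure of S by limits. *)
definition closure_extension ::
    "'a::metric_space set \<Rightarrow> ('a \<Rightarrow> real) \<Rightarrow> 'a \<Rightarrow> real" where
  "closure_extension S u x = (if x \<in> S then u x else Lim (at x within S) u)"

end

theory Submission
  imports Defs
begin

text \<open>
  The idea is to test the differential inequality with the level sets of \<open>u\<close> themselves, so that
  no travelling front has to be constructed. Extend \<open>u\<close> to the closure \<open>T\<close> of the complement of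
  \<open>K\<close>, let \<open>D\<close> be the distance to \<open>K\<close>, and suppose that the infimum \<open>m\<close> of \<open>u\<close> is below \<open>1\<close>. For
  each level \<open>l\<close> strictly between \<open>m\<close> and \<open>1\<close> the sublevel set of \<open>u\<close> is compact, because \<open>u\<close> tends
  to \<open>1\<close> at infinity; let \<open>X l\<close> be a point of it at the largest distance \<open>t l\<close> from \<open>K\<close>. Then
  \<open>u (X l) = l\<close>, and \<open>u \<ge> l\<close> wherever \<open>D \<ge> t l\<close> (\<open>last_point_below_level\<close>).

  Convexity of \<open>K\<close> enters through the unit normal \<open>E l\<close> of \<open>K\<close> towards \<open>X l\<close>: the affine function
  \<open>t l + (z - X l) \<bullet> E l\<close> is at most \<open>D z\<close> for every \<open>z\<close> (\<open>infdist_unit_subgradient\<close>). Hence, for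
  \<open>k > l\<close>, the set \<open>u \<ge> k\<close> contains the half-space orthogonal to \<open>E l\<close> at distance \<open>t k - t l\<close> in front
  of \<open>X l\<close>, this half-space avoids \<open>K\<close>, and for \<open>k < l\<close> the set \<open>u < k\<close> lies in the half-space at
  distance \<open>t l - t k\<close> behind \<open>X l\<close>. Write \<open>H a\<close> for the mass that the jump kernel gives to a half-space
  at distance \<open>a\<close> (\<open>halfspace_mass\<close>); by rotation invariance it does not depend on the direction. Decomposing \<open>u - l\<close>
  into its levels, the operator at \<open>X l\<close>, up to its normalization constant \<open>\<gamma>\<close>, is at least
    \<open>(INT k from l to 1. H (t k - t l)) - (INT k from m to l. H (t l - t k))\<close>
  (\<open>jump_integral_level_bound\<close>), and so this difference is at most \<open>- f l / \<gamma>\<close>.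

  Now integrate over \<open>l\<close> from \<open>m\<close> to \<open>1\<close>. The two double integrals on the left are exchanged by
  swapping \<open>k\<close> and \<open>l\<close>, so they are equal. They are also finite (\<open>flux_balance\<close>): Hoelder continuity
  of \<open>u\<close> with exponent \<open>b > 2 * s\<close> bounds \<open>t k - t l\<close> from below by a multiple of
  \<open>(k - l) powr (1 / b)\<close>, so that \<open>H (t k - t l)\<close> is at most a multiple of
  \<open>(k - l) powr (- 2 * s / b)\<close>, which is integrable. Therefore the integral of \<open>f\<close> from \<open>m\<close> to
  \<open>1\<close> is at most \<open>0\<close>. But for a bistable \<open>f\<close> with positive total integral every integral from
  \<open>m < 1\<close> up to \<open>1\<close> is positive (\<open>bistable_integral_pos\<close>), a contradiction.

  The points \<open>X l\<close> may lie on the boundary of \<open>K\<close>, where the inequality is not assumed; it is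
  inherited from nearby points by Fatou's lemma (\<open>jump_integral_le_limit\<close>). At interior points
  the principal value is an absolutely convergent integral, again because \<open>b > 2 * s\<close>
  (\<open>regional_frac_laplacian_eq\<close>).
\<close>

section \<open>Invariance of Lebesgue measure under isometries\<close>

lemma nn_integral_lborel_translate:
  fixes h :: "'a::euclidean_space \<Rightarrow> ennreal"
  assumes [measurable]: "h \<in> borel_measurable borel"
  shows "(\<integral>\<^sup>+y. h (c + y) \<partial>lborel) = (\<integral>\<^sup>+y. h y \<partial>lborel)"
proof -
  have "(\<integral>\<^sup>+y. h y \<partial>lborel) = (\<integral>\<^sup>+y. h y \<partial>distr lborel borel ((+) c))"
    by (simp add: lborel_distr_plus)
  also have "\<dots> = (\<integral>\<^sup>+y. h (c + y) \<partial>lborel)"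
    by (subst nn_integral_distr) auto
  finally show ?thesis by simp
qed

lemma nn_integral_lborel_translate_minus:
  fixes h :: "'a::euclidean_space \<Rightarrow> ennreal"
  assumes "h \<in> borel_measurable borel"
  shows "(\<integral>\<^sup>+y. h (y - x) \<partial>lborel) = (\<integral>\<^sup>+y. h y \<partial>lborel)"
  using nn_integral_lborel_translate[OF assms, of "- x"] by simp

lemma nn_integral_lborel_reflect:
  fixes h :: "'a::euclidean_space \<Rightarrow> ennreal"
  assumes [measurable]: "h \<in> borel_measurable borel"
  shows "(\<integral>\<^sup>+y. h (c - y) \<partial>lborel) = (\<integral>\<^sup>+y. h y \<partial>lborel)"
proof -
  have eq: "lborel = distr lborel borel (\<lambda>y::'a. c + (-1) *\<^sub>R y)"
    by (subst lborel_affine[of "-1" c]) (simp_all add: density_1)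
  have "(\<integral>\<^sup>+y. h y \<partial>lborel) = (\<integral>\<^sup>+y. h y \<partial>distr lborel borel (\<lambda>y::'a. c + (-1) *\<^sub>R y))"
    by (subst eq) simp
  also have "\<dots> = (\<integral>\<^sup>+y. h (c - y) \<partial>lborel)"
    by (subst nn_integral_distr) auto
  finally show ?thesis by simp
qed

text \<open>Haar uniqueness for one pair of measures. With \<open>b\<close> the indicator of the unit ball, evaluate the
  double integral of \<open>h (f y) * b (f y - x)\<close> over \<open>x\<close> and \<open>y\<close> in two ways. Integrating over \<open>x\<close> first
  gives the left-hand side times the volume \<open>V\<close> of the ball. Translating \<open>y\<close> by a preimage of \<open>x\<close>
  first gives \<open>h (f y + x) * b (f y)\<close>; as \<open>f\<close> preserves the ball, the result is \<open>V\<close> times the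
  right-hand side.\<close>

lemma nn_integral_lborel_orthogonal:
  fixes h :: "'a::euclidean_space \<Rightarrow> ennreal" and f :: "'a \<Rightarrow> 'a"
  assumes [measurable]: "h \<in> borel_measurable borel"
    and f: "orthogonal_transformation f"
  shows "(\<integral>\<^sup>+y. h (f y) \<partial>lborel) = (\<integral>\<^sup>+y. h y \<partial>lborel)"
proof -
  have lin: "linear f" and nf: "\<And>y. norm (f y) = norm y"
    using f by (auto simp: orthogonal_transformation)
  have cont: "continuous_on UNIV f"
    using lin linear_continuous_on linear_conv_bounded_linear by blast
  have fm[measurable]: "f \<in> borel_measurable borel"
    by (rule borel_measurable_continuous_onI[OF cont])
  define b where "b = (\<lambda>y::'a. indicator (ball 0 1) y :: ennreal)"
  have [measurable]: "b \<in> borel_measurable borel"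
    unfolding b_def by (intro borel_measurable_indicator) auto
  have bf: "b (f y) = b y" for y by (auto simp: b_def nf indicator_def)
  define V where "V = (\<integral>\<^sup>+y. b y \<partial>(lborel :: 'a measure))"
  have V: "V = emeasure lborel (ball (0::'a) 1)"
    unfolding V_def b_def by (subst nn_integral_indicator) auto
  have V': "V = ennreal (unit_ball_vol (DIM('a)))"
    using V emeasure_ball[of 1 "0::'a"] by simp
  have Vpos: "V \<noteq> 0" "V \<noteq> \<infinity>"
    using unit_ball_vol_pos[of "real DIM('a)"] by (auto simp: V' ennreal_eq_0_iff not_le[symmetric] simp del: unit_ball_vol_pos)
  have "(\<integral>\<^sup>+x. \<integral>\<^sup>+y. h (f y) * b (f y - x) \<partial>lborel \<partial>(lborel :: 'a measure))
      = (\<integral>\<^sup>+y. \<integral>\<^sup>+x. h (f y) * b (f y - x) \<partial>(lborel :: 'a measure) \<partial>lborel)"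
    by (rule lborel_pair.Fubini') measurable
  also have "\<dots> = (\<integral>\<^sup>+y. h (f y) * V \<partial>lborel)"
    by (intro nn_integral_cong) (simp add: nn_integral_cmult nn_integral_lborel_reflect[of b] V_def)
  also have "\<dots> = (\<integral>\<^sup>+y. h (f y) \<partial>lborel) * V"
    by (rule nn_integral_multc) measurable
  finally have 1: "(\<integral>\<^sup>+x. \<integral>\<^sup>+y. h (f y) * b (f y - x) \<partial>lborel \<partial>(lborel :: 'a measure))
      = (\<integral>\<^sup>+y. h (f y) \<partial>lborel) * V" .
  have "(\<integral>\<^sup>+y. h (f y) * b (f y - x) \<partial>lborel) = (\<integral>\<^sup>+y. h (f y + x) * b y \<partial>lborel)" for x
  proof -
    obtain z where z: "f z = x"
      using orthogonal_transformation_surj[OF f] by (metis surjD)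
    have "(\<integral>\<^sup>+y. h (f (z + y)) * b (f (z + y) - x) \<partial>lborel) = (\<integral>\<^sup>+y. h (f y) * b (f y - x) \<partial>lborel)"
      by (rule nn_integral_lborel_translate[where h = "\<lambda>y. h (f y) * b (f y - x)"]) measurable
    then show ?thesis
      by (simp add: linear_add[OF lin] z bf add.commute)
  qed
  then have "(\<integral>\<^sup>+x. \<integral>\<^sup>+y. h (f y) * b (f y - x) \<partial>lborel \<partial>(lborel :: 'a measure))
      = (\<integral>\<^sup>+x. \<integral>\<^sup>+y. h (f y + x) * b y \<partial>lborel \<partial>(lborel :: 'a measure))"
    by simp
  also have "\<dots> = (\<integral>\<^sup>+y. \<integral>\<^sup>+x. h (f y + x) * b y \<partial>(lborel :: 'a measure) \<partial>lborel)"
    by (rule lborel_pair.Fubini') measurable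
  also have "\<dots> = (\<integral>\<^sup>+y. (\<integral>\<^sup>+x. h x \<partial>lborel) * b y \<partial>lborel)"
    by (intro nn_integral_cong) (simp add: nn_integral_multc nn_integral_lborel_translate)
  also have "\<dots> = (\<integral>\<^sup>+x. h x \<partial>lborel) * V"
    unfolding V_def by (rule nn_integral_cmult) measurable
  finally have "(\<integral>\<^sup>+y. h (f y) \<partial>lborel) * V = (\<integral>\<^sup>+x. h x \<partial>lborel) * V"
    using 1 by simp
  then show ?thesis
    using Vpos by (metis mult_divide_eq_ennreal infinity_ennreal_def)
qed

section \<open>Integrals of power kernels\<close>

text \<open>A dominating step function: where \<open>h\<close> does not vanish, it is at most \<open>c j\<close> on one of the balls of
  radius \<open>r j\<close>. Dyadic radii turn this into the bounds for power kernels that follow.\<close>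

lemma nn_integral_shells:
  fixes h :: "'a::euclidean_space \<Rightarrow> ennreal" and r :: "nat \<Rightarrow> real" and A :: "'a set"
  assumes [measurable]: "h \<in> borel_measurable borel"
    and r: "\<And>j. r j \<ge> 0"
    and c: "\<And>j. c j \<ge> 0"
    and cover: "\<And>z. z \<in> A \<Longrightarrow> h z \<noteq> 0 \<Longrightarrow> \<exists>j. norm z \<le> r j \<and> h z \<le> ennreal (c j)"
    and sum: "summable (\<lambda>j. c j * r j ^ DIM('a))"
  shows "(\<integral>\<^sup>+z. h z * indicator A z \<partial>lborel)
     \<le> ennreal (unit_ball_vol (DIM('a)) * (\<Sum>j. c j * r j ^ DIM('a)))"
proof -
  let ?V = "unit_ball_vol (real DIM('a))"
  have [measurable]: "(\<lambda>z::'a. indicator (cball 0 (r j)) z :: ennreal) \<in> borel_measurable borel" for j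
    by (rule borel_measurable_indicator) simp
  have le: "h z * indicator A z \<le> (\<Sum>j. ennreal (c j) * indicator (cball 0 (r j)) z)" for z
  proof (cases "z \<in> A \<and> h z \<noteq> 0")
    case True
    then obtain j where j: "norm z \<le> r j" "h z \<le> ennreal (c j)" using cover by blast
    then have "h z * indicator A z \<le> ennreal (c j) * indicator (cball 0 (r j)) z"
      using True by (simp add: indicator_def)
    also have "\<dots> = (\<Sum>i\<in>{j}. ennreal (c i) * indicator (cball 0 (r i)) z)"
      by (subst sum.insert) auto
    also have "\<dots> \<le> (\<Sum>j. ennreal (c j) * indicator (cball 0 (r j)) z)"
      by (rule sum_le_suminf) auto
    finally show ?thesis .
  qed (auto simp: indicator_def)
  have "(\<integral>\<^sup>+z. h z * indicator A z \<partial>lborel)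
      \<le> (\<integral>\<^sup>+z. (\<Sum>j. ennreal (c j) * indicator (cball 0 (r j)) z) \<partial>(lborel :: 'a measure))"
    by (rule nn_integral_mono) (rule le)
  also have "\<dots> = (\<Sum>j. \<integral>\<^sup>+z. ennreal (c j) * indicator (cball 0 (r j)) z \<partial>(lborel :: 'a measure))"
    by (rule nn_integral_suminf) simp
  also have "\<dots> = (\<Sum>j. ennreal (?V * (c j * r j ^ DIM('a))))"
    by (simp add: nn_integral_cmult emeasure_cball r c ennreal_mult[symmetric] mult_ac)
  also have "\<dots> = ennreal (\<Sum>j. ?V * (c j * r j ^ DIM('a)))"
    using r c by (intro suminf_ennreal2 summable_mult sum) auto
  also have "\<dots> = ennreal (?V * (\<Sum>j. c j * r j ^ DIM('a)))"
    by (subst suminf_mult[OF sum]) simp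
  finally show ?thesis .
qed

text \<open>On the shell where \<open>norm z\<close> is between \<open>2 ^ j * a\<close> and \<open>2 ^ Suc j * a\<close>, the kernel is at most its
  value on the inner sphere, and the volume is at most that of the outer ball; this gives a geometric
  series with ratio \<open>2 powr (DIM('a) - p)\<close>.\<close>

lemma nn_integral_riesz_tail:
  fixes p :: real
  assumes p: "p > DIM('a::euclidean_space)"
  obtains B where "B \<ge> 0" "\<And>a. a > 0 \<Longrightarrow>
    (\<integral>\<^sup>+z. ennreal (1 / norm z powr p) * indicator {z. a \<le> norm z} z \<partial>(lborel :: 'a measure))
       \<le> ennreal (B * a powr (DIM('a) - p))"
proof -
  define n where "n = DIM('a)"
  let ?V = "unit_ball_vol (real n)"
  let ?\<rho> = "2 powr (real n - p)"
  have \<rho>: "0 < ?\<rho>" "?\<rho> < 1" using p by (auto simp: n_def powr_less_one)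
  have geo: "summable (\<lambda>j. ?\<rho> ^ j)" using \<rho> by (intro summable_geometric) auto
  have main: "(\<integral>\<^sup>+z. ennreal (1 / norm z powr p) * indicator {z. a \<le> norm z} z \<partial>(lborel :: 'a measure))
       \<le> ennreal ((?V * 2 ^ n * (\<Sum>j. ?\<rho> ^ j)) * a powr (real n - p))" if a: "a > 0" for a
  proof -
    define r where "r = (\<lambda>j. 2 ^ Suc j * a)"
    define c where "c = (\<lambda>j. 1 / (2 ^ j * a) powr p)"
    have cr: "c j * r j ^ n = 2 ^ n * a powr (real n - p) * ?\<rho> ^ j" for j
    proof -
      have "r j ^ n = 2 ^ n * (2 ^ j * a) powr n"
        using a by (simp add: r_def powr_realpow power_mult_distrib)
      then have "c j * r j ^ n = 2 ^ n * (2 ^ j * a) powr (real n - p)"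
        by (simp add: c_def powr_diff)
      also have "(2 ^ j * a) powr (real n - p) = ?\<rho> ^ j * a powr (real n - p)"
        using a by (simp add: powr_mult powr_realpow[symmetric] powr_powr mult.commute)
      finally show ?thesis by simp
    qed
    have sum: "summable (\<lambda>j. c j * r j ^ n)"
      unfolding cr by (intro summable_mult geo)
    have cover: "\<exists>j. norm z \<le> r j \<and> ennreal (1 / norm z powr p) \<le> ennreal (c j)"
      if z: "z \<in> {z. a \<le> norm z}" for z :: 'a
    proof -
      define j where "j = (LEAST j. norm z \<le> r j)"
      obtain i where "norm z / a < 2 ^ i" using real_arch_pow[of 2] by auto
      then have "norm z \<le> 2 ^ i * a" using a by (simp add: field_simps)
      also have "\<dots> \<le> r i" using a by (simp add: r_def)
      finally have "norm z \<le> r i" .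
      then have j1: "norm z \<le> r j" unfolding j_def by (rule LeastI)
      have j2: "2 ^ j * a \<le> norm z"
      proof (cases j)
        case 0 then show ?thesis using z by simp
      next
        case (Suc i)
        then have "\<not> norm z \<le> r i" unfolding j_def by (metis lessI not_less_Least)
        then show ?thesis by (simp add: r_def Suc)
      qed
      have "1 / norm z powr p \<le> c j"
        unfolding c_def using j2 a p less_le_trans[of 0 "2 ^ j * a" "norm z"]
        by (intro divide_left_mono powr_mono2 mult_pos_pos) auto
      then show ?thesis using j1 by (blast intro: ennreal_leI)
    qed
    have "(\<integral>\<^sup>+z. ennreal (1 / norm z powr p) * indicator {z. a \<le> norm z} z \<partial>(lborel :: 'a measure))
      \<le> ennreal (?V * (\<Sum>j. c j * r j ^ n))"
      unfolding n_def by (rule nn_integral_shells)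
        (use a cover sum in \<open>auto simp: r_def c_def n_def\<close>)
    also have "(\<Sum>j. c j * r j ^ n) = 2 ^ n * a powr (real n - p) * (\<Sum>j. ?\<rho> ^ j)"
      unfolding cr by (rule suminf_mult[OF geo])
    finally show ?thesis by (simp add: mult_ac)
  qed
  show thesis
    by (rule that[of "?V * 2 ^ n * (\<Sum>j. ?\<rho> ^ j)"])
      (use main in \<open>auto simp: n_def intro!: mult_nonneg_nonneg suminf_nonneg geo[unfolded n_def]\<close>)
qed

text \<open>The same computation on shells shrinking to the origin; the ratio is now
  \<open>2 powr (q - DIM('a))\<close>.\<close>

lemma nn_integral_riesz_near:
  fixes q :: real
  assumes q: "0 \<le> q" "q < DIM('a::euclidean_space)"
  shows "(\<integral>\<^sup>+z. ennreal (1 / norm z powr q) * indicator (cball 0 1) z \<partial>(lborel :: 'a measure)) < \<infinity>"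
proof -
  define n where "n = DIM('a)"
  let ?\<rho> = "2 powr (q - real n)"
  have \<rho>: "0 < ?\<rho>" "?\<rho> < 1" using q by (auto simp: n_def powr_less_one)
  have geo: "summable (\<lambda>j. ?\<rho> ^ j)" using \<rho> by (intro summable_geometric) auto
  define r :: "nat \<Rightarrow> real" where "r = (\<lambda>j. (1/2) ^ j)"
  define c where "c = (\<lambda>j. 2 powr q * 2 powr (q * real j))"
  have cr: "c j * r j ^ n = 2 powr q * ?\<rho> ^ j" for j
  proof -
    have "r j ^ n = 2 powr (- real n * real j)"
      by (simp add: r_def powr_minus powr_realpow power_mult[symmetric] power_one_over field_simps powr_mult_base
          flip: of_nat_mult)
    then have "c j * r j ^ n = 2 powr q * 2 powr ((q - real n) * real j)"
      by (simp add: c_def powr_add[symmetric] algebra_simps)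
    then show ?thesis by (simp add: powr_realpow[symmetric] powr_powr)
  qed
  have sum: "summable (\<lambda>j. c j * r j ^ n)"
    unfolding cr by (intro summable_mult geo)
  have cover: "\<exists>j. norm z \<le> r j \<and> ennreal (1 / norm z powr q) \<le> ennreal (c j)"
    if z: "z \<in> cball 0 1" and nz: "z \<noteq> 0" for z :: 'a
  proof -
    define j where "j = (LEAST j. r (Suc j) < norm z)"
    obtain i where "(1/2) ^ i < norm z" using real_arch_pow_inv[of "norm z" "1/2"] nz by auto
    moreover have "(1/2) ^ Suc i \<le> (1/2::real) ^ i" by simp
    ultimately have "r (Suc i) < norm z" unfolding r_def by linarith
    then have j1: "r (Suc j) < norm z" unfolding j_def by (rule LeastI)
    have j2: "norm z \<le> r j"
    proof (cases j)
      case 0 then show ?thesis using z by (simp add: r_def)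
    next
      case (Suc i)
      then have "\<not> r (Suc i) < norm z" unfolding j_def by (metis lessI not_less_Least)
      then show ?thesis by (simp add: Suc)
    qed
    have "1 / norm z powr q \<le> 1 / r (Suc j) powr q"
      using j1 q nz by (intro divide_left_mono powr_mono2) (auto simp: r_def)
    also have "r (Suc j) = 2 powr (- (1 + real j))"
      by (simp add: r_def powr_diff powr_minus powr_realpow power_one_over field_simps)
    also have "1 / (2 powr (- (1 + real j))) powr q = c j"
      by (simp add: c_def powr_powr powr_add[symmetric] powr_minus[symmetric] divide_inverse algebra_simps)
    finally show ?thesis using j2 by (blast intro: ennreal_leI)
  qed
  have "(\<integral>\<^sup>+z. ennreal (1 / norm z powr q) * indicator (cball 0 1) z \<partial>(lborel :: 'a measure))
      \<le> ennreal (unit_ball_vol (real n) * (\<Sum>j. c j * r j ^ n))"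
    unfolding n_def
  proof (rule nn_integral_shells)
    fix z :: 'a assume "z \<in> cball 0 1" "ennreal (1 / norm z powr q) \<noteq> 0"
    then show "\<exists>j. norm z \<le> r j \<and> ennreal (1 / norm z powr q) \<le> ennreal (c j)"
      by (intro cover) auto
  qed (use sum in \<open>auto simp: r_def c_def n_def\<close>)
  then show ?thesis by (simp add: order.strict_trans1)
qed

text \<open>Up to translation, this function dominates the integrand of the jump operator for a Hoelder
  continuous function with values in the unit interval: the numerator is bounded by \<open>1\<close> far away and by
  the Hoelder modulus nearby.\<close>

lemma integrable_holder_kernel:
  fixes M b p :: real
  assumes "0 \<le> M" and p: "p > DIM('a::euclidean_space)" and b: "b \<le> p" "p - b < DIM('a)"
  shows "integrable lborel (\<lambda>z::'a. min 1 (M * norm z powr b) / norm z powr p)"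
proof (rule integrableI_nonneg)
  let ?g = "\<lambda>z::'a. min 1 (M * norm z powr b) / norm z powr p"
  show "AE z in lborel. 0 \<le> ?g z" using assms by auto
  have [measurable]: "(\<lambda>z::'a. indicator (cball 0 1) z :: ennreal) \<in> borel_measurable borel"
    by (rule borel_measurable_indicator) simp
  obtain B where B: "B \<ge> 0" "\<And>a. a > 0 \<Longrightarrow>
    (\<integral>\<^sup>+z. ennreal (1 / norm z powr p) * indicator {z. a \<le> norm z} z \<partial>(lborel :: 'a measure))
       \<le> ennreal (B * a powr (DIM('a) - p))" using nn_integral_riesz_tail[OF p] by blast
  have "ennreal (?g z) \<le> ennreal (1 / norm z powr p) * indicator {z. 1 \<le> norm z} z
      + ennreal M * (ennreal (1 / norm z powr (p - b)) * indicator (cball 0 1) z)" for z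
  proof (cases "1 \<le> norm z")
    case True
    have "?g z \<le> 1 / norm z powr p" by (intro divide_right_mono) auto
    then have "ennreal (?g z) \<le> ennreal (1 / norm z powr p) * indicator {z. 1 \<le> norm z} z"
      using True by (simp add: ennreal_leI)
    then show ?thesis by (simp add: add_increasing2)
  next
    case False
    have "?g z \<le> M * norm z powr b / norm z powr p" by (intro divide_right_mono) auto
    also have "\<dots> = M * (1 / norm z powr (p - b))" by (simp add: powr_diff)
    finally have "ennreal (?g z) \<le> ennreal M * ennreal (1 / norm z powr (p - b))"
      using assms by (simp add: ennreal_mult[symmetric] ennreal_leI)
    then show ?thesis using False by (simp add: )
  qed
  then have "(\<integral>\<^sup>+z. ennreal (?g z) \<partial>lborel) \<le>
    (\<integral>\<^sup>+z. ennreal (1 / norm z powr p) * indicator {z. 1 \<le> norm z} z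
      + ennreal M * (ennreal (1 / norm z powr (p - b)) * indicator (cball 0 1) z) \<partial>(lborel :: 'a measure))"
    by (rule nn_integral_mono)
  also have "\<dots> = (\<integral>\<^sup>+z. ennreal (1 / norm z powr p) * indicator {z. 1 \<le> norm z} z \<partial>(lborel::'a measure))
    + ennreal M * (\<integral>\<^sup>+z. ennreal (1 / norm z powr (p - b)) * indicator (cball 0 1) z \<partial>(lborel::'a measure))"
    by (simp add: nn_integral_add nn_integral_cmult)
  also have "\<dots> < \<infinity>"
    using B(2)[of 1] nn_integral_riesz_near[of "p - b", where 'a='a] b
    by (auto simp: ennreal_mult_less_top order.strict_trans1)
  finally show "(\<integral>\<^sup>+z. ennreal (?g z) \<partial>lborel) < \<infinity>" .
qed measurable

definition halfspace_mass :: "real \<Rightarrow> real \<Rightarrow> 'a::euclidean_space \<Rightarrow> ennreal" where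
  "halfspace_mass p a e = (\<integral>\<^sup>+z. ennreal (1 / norm z powr p) * indicator {z. a \<le> z \<bullet> e} z \<partial>lborel)"

lemma halfspace_mass_direction:
  fixes e e' :: "real ^ 'n"
  assumes "norm e = norm e'"
  shows "halfspace_mass p a e = halfspace_mass p a e'"
proof -
  obtain f where f: "orthogonal_transformation f" "f e = e'"
    using orthogonal_transformation_exists[OF assms] .
  have *: "f z \<bullet> e' = z \<bullet> e" "norm (f z) = norm z" for z
    using f by (auto simp: orthogonal_transformation_def orthogonal_transformation_norm[OF f(1)])
  have "halfspace_mass p a e' = (\<integral>\<^sup>+z. ennreal (1 / norm (f z) powr p) * indicator {z. a \<le> z \<bullet> e'} (f z) \<partial>lborel)"
    unfolding halfspace_mass_def
    by (rule nn_integral_lborel_orthogonal[OF _ f(1), symmetric]) measurable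
  also have "\<dots> = halfspace_mass p a e"
    unfolding halfspace_mass_def by (simp add: * indicator_def)
  finally show ?thesis by simp
qed

lemma halfspace_mass_le:
  fixes p :: real
  assumes p: "p > DIM('a::euclidean_space)"
  obtains B where "B \<ge> 0"
    "\<And>a (e::'a). a > 0 \<Longrightarrow> norm e = 1 \<Longrightarrow> halfspace_mass p a e \<le> ennreal (B * a powr (DIM('a) - p))"
proof -
  obtain B where B: "B \<ge> 0" "\<And>a. a > 0 \<Longrightarrow>
    (\<integral>\<^sup>+z. ennreal (1 / norm z powr p) * indicator {z. a \<le> norm z} z \<partial>(lborel :: 'a measure))
       \<le> ennreal (B * a powr (DIM('a) - p))" using nn_integral_riesz_tail[OF p] by blast
  have "halfspace_mass p a e \<le> ennreal (B * a powr (DIM('a) - p))" if "a > 0" "norm e = 1" for a and e :: 'a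
  proof -
    have "a \<le> norm z" if "a \<le> z \<bullet> e" for z
      using that Cauchy_Schwarz_ineq2[of z e] \<open>norm e = 1\<close> by simp
    then have "halfspace_mass p a e \<le>
       (\<integral>\<^sup>+z. ennreal (1 / norm z powr p) * indicator {z. a \<le> norm z} z \<partial>(lborel :: 'a measure))"
      unfolding halfspace_mass_def by (intro nn_integral_mono mult_left_mono) (auto simp: indicator_def)
    also note B(2)[OF that(1)]
    finally show ?thesis .
  qed
  then show thesis using that B(1) by blast
qed

section \<open>Convexity: unit subgradients of the distance\<close>

text \<open>The distance to a convex set is a convex function. Outside the set its subgradient is the unit vector
  pointing away from the nearest point; at a boundary point, any outer unit normal serves.\<close>

lemma infdist_unit_subgradient:
  fixes C :: "'a::euclidean_space set"
  assumes C: "closed C" "convex C" "C \<noteq> {}" and x: "x \<notin> interior C"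
  obtains e where "norm e = 1" "\<And>z. (z - x) \<bullet> e \<le> infdist z C - infdist x C"
proof -
  have near: "\<exists>q\<in>C. infdist z C = dist z q" for z
    using infdist_attains_inf[OF C(1,3)] by metis
  \<comment> \<open>an outer unit normal \<open>e\<close> of \<open>C\<close> at a point \<open>q\<close> nearest to \<open>x\<close>\<close>
  have "\<exists>e q. norm e = 1 \<and> (x - q) \<bullet> e = infdist x C \<and> (\<forall>w\<in>C. (w - q) \<bullet> e \<le> 0)"
  proof (cases "x \<in> C")
    case True
    obtain a where a: "a \<noteq> 0" "\<And>y. y \<in> C \<Longrightarrow> a \<bullet> x \<le> a \<bullet> y"
    proof (cases "interior C = {}")
      case True
      obtain a b where ab: "a \<noteq> 0" "C \<subseteq> {z. a \<bullet> z = b}"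
        using empty_interior_subset_hyperplane[OF C(2) True] by blast
      have "a \<bullet> y = b" if "y \<in> C" for y using ab that by auto
      then show ?thesis using ab \<open>x \<in> C\<close> by (intro that[of a]) auto
    next
      case False
      then have "x \<notin> rel_interior C" using x by (simp add: rel_interior_nonempty_interior)
      then show ?thesis
        using supporting_hyperplane_rel_boundary[OF C(2) \<open>x \<in> C\<close>] that by metis
    qed
    show ?thesis
    proof (rule exI[of _ "- (a /\<^sub>R norm a)"], rule exI[of _ x], intro conjI ballI)
      show "norm (- (a /\<^sub>R norm a)) = 1" using a by simp
      fix w assume "w \<in> C"
      then have "a \<bullet> x \<le> a \<bullet> w" by (rule a)
      then have "0 \<le> inverse (norm a) * (a \<bullet> (w - x))" by (simp add: inner_diff_right)
      then show "(w - x) \<bullet> - (a /\<^sub>R norm a) \<le> 0" by (simp add: inner_commute)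
    qed (use True in auto)
  next
    case False
    obtain q where q: "q \<in> C" "infdist x C = dist x q" using near by blast
    have n: "norm (x - q) \<noteq> 0" using False q by auto
    show ?thesis
    proof (rule exI[of _ "(x - q) /\<^sub>R norm (x - q)"], rule exI[of _ q], intro conjI ballI)
      show "norm ((x - q) /\<^sub>R norm (x - q)) = 1" using n by simp
      show "(x - q) \<bullet> ((x - q) /\<^sub>R norm (x - q)) = infdist x C"
        using n q(2) by (simp add: dist_norm power2_norm_eq_inner[symmetric] power2_eq_square)
      fix w assume w: "w \<in> C"
      have "(x - q) \<bullet> (w - q) \<le> 0"
        by (rule any_closest_point_dot[OF C(2,1) q(1) w]) (metis q(2) infdist_le)
      then show "(w - q) \<bullet> ((x - q) /\<^sub>R norm (x - q)) \<le> 0"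
        by (simp add: inner_commute mult_nonneg_nonpos)
    qed
  qed
  then obtain e q where e: "norm e = 1" "(x - q) \<bullet> e = infdist x C" "\<And>w. w \<in> C \<Longrightarrow> (w - q) \<bullet> e \<le> 0"
    by blast
  show thesis
  proof (rule that[OF e(1)])
    fix z
    obtain w where w: "w \<in> C" "infdist z C = dist z w" using near by blast
    have "(z - w) \<bullet> e \<le> norm (z - w)"
      using Cauchy_Schwarz_ineq2[of "z - w" e] e(1) by simp
    then show "(z - x) \<bullet> e \<le> infdist z C - infdist x C"
      using e(2) e(3)[OF w(1)] w(2) by (simp add: inner_diff_left dist_norm)
  qed
qed

section \<open>The regional operator as an absolutely convergent integral\<close>

text \<open>The bound with \<open>min 1\<close> combines Hoelder continuity near \<open>x\<close> with boundedness far away. The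
  dominating function is a translate of a fixed one, so its integral does not depend on \<open>x\<close>; this is
  what makes Fatou's lemma applicable along a sequence of centres below.\<close>

lemma integrable_jump_integrand:
  fixes v :: "'a::euclidean_space \<Rightarrow> real"
  assumes [measurable]: "S \<in> sets borel" and meas: "(\<lambda>y. indicator S y * v y) \<in> borel_measurable borel"
    and G: "integrable lborel (\<lambda>z::'a. min 1 (M * norm z powr b) / norm z powr p)"
    and "0 \<le> M" and bound: "\<And>y. y \<in> S \<Longrightarrow> \<bar>v y - c\<bar> \<le> min 1 (M * dist x y powr b)"
  shows "integrable lborel (\<lambda>y. indicator S y * ((v y - c) / dist x y powr p))" (is "integrable _ ?F")
    and "integrable lborel (\<lambda>y. min 1 (M * dist x y powr b) / dist x y powr p)"
    and "(LINT y|lborel. min 1 (M * dist x y powr b) / dist x y powr p) =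
         (LINT z|lborel. min 1 (M * norm (z::'a) powr b) / norm z powr p)"
    and "\<And>y. \<bar>indicator S y * ((v y - c) / dist x y powr p)\<bar> \<le> min 1 (M * dist x y powr b) / dist x y powr p"
    and "(\<lambda>y. indicator S y * ((v y - c) / dist x y powr p)) \<in> borel_measurable borel"
proof -
  let ?G = "\<lambda>z::'a. min 1 (M * norm z powr b) / norm z powr p"
  have shift: "(\<lambda>y. min 1 (M * dist x y powr b) / dist x y powr p) = (\<lambda>y. ?G (- x + y))"
    by (rule ext) (simp add: dist_norm norm_minus_commute)
  have "integrable (distr lborel borel ((+) (- x))) ?G"
    using G by (simp add: lborel_distr_plus)
  then have "integrable lborel (\<lambda>y. ?G (- x + y))"
    by (subst (asm) integrable_distr_eq) auto
  then show G2: "integrable lborel (\<lambda>y. min 1 (M * dist x y powr b) / dist x y powr p)"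
    unfolding shift .
  have "(LINT z|lborel. ?G z) = (LINT z|distr lborel borel ((+) (- x)). ?G z)"
    by (simp add: lborel_distr_plus)
  also have "\<dots> = (LINT y|lborel. ?G (- x + y))"
    by (subst integral_distr) auto
  finally show "(LINT y|lborel. min 1 (M * dist x y powr b) / dist x y powr p) = (LINT z|lborel. ?G z)"
    unfolding shift by simp
  have "?F = (\<lambda>y. (indicator S y * v y - indicator S y * c) / dist x y powr p)"
    by (rule ext) (simp add: indicator_def)
  also have "\<dots> \<in> borel_measurable borel" using meas by measurable
  finally show m: "?F \<in> borel_measurable borel" .
  show le: "\<bar>?F y\<bar> \<le> min 1 (M * dist x y powr b) / dist x y powr p" for y
  proof (cases "y \<in> S")
    case True
    then show ?thesis using bound[OF True] by (simp add: abs_mult divide_right_mono)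
  next
    case False
    then show ?thesis using \<open>0 \<le> M\<close> by simp
  qed
  show "integrable lborel ?F"
  proof (rule Bochner_Integration.integrable_bound[OF G2])
    show "?F \<in> borel_measurable lborel" using m by simp
    show "AE y in lborel. norm (?F y) \<le> norm (min 1 (M * dist x y powr b) / dist x y powr p)"
      unfolding real_norm_def by (intro AE_I2 order_trans[OF le abs_ge_self])
  qed
qed

text \<open>Dominated convergence removes the truncation near \<open>x\<close>.\<close>

lemma regional_frac_laplacian_eq:
  fixes K :: "(real ^ 'n) set" and s :: real
  assumes [measurable]: "K \<in> sets borel"
    and meas: "(\<lambda>y. indicator (- K) y * u y) \<in> borel_measurable borel"
    and G: "integrable lborel (\<lambda>z::real^'n. min 1 (M * norm z powr b) / norm z powr (CARD('n) + 2 * s))"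
    and M: "0 \<le> M" and bound: "\<And>y. y \<notin> K \<Longrightarrow> \<bar>u y - u x\<bar> \<le> min 1 (M * dist x y powr b)"
  shows "regional_frac_laplacian s K u x = frac_laplacian_const CARD('n) s *
    (LINT y|lborel. indicator (- K) y * ((u y - u x) / dist x y powr (CARD('n) + 2 * s)))"
proof -
  define F where "F = (\<lambda>y. indicator (- K) y * ((u y - u x) / dist x y powr (CARD('n) + 2 * s)))"
  define G where "G = (\<lambda>y. min 1 (M * dist x y powr b) / dist x y powr (CARD('n) + 2 * s))"
  have K': "- K \<in> sets borel" by simp
  have bound': "\<bar>u y - u x\<bar> \<le> min 1 (M * dist x y powr b)" if "y \<in> - K" for y
    using bound that by blast
  note jump = integrable_jump_integrand[OF K' meas G M bound']
  have G_int: "integrable lborel G" unfolding G_def by (rule jump(2))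
  have FG: "\<bar>F y\<bar> \<le> G y" for y unfolding F_def G_def by (rule jump(4))
  have Fm[measurable]: "F \<in> borel_measurable borel" unfolding F_def by (rule jump(5))
  let ?X = "\<lambda>\<epsilon>. LINT y : {y. y \<notin> K \<and> dist x y > \<epsilon>} | lborel. (u y - u x) / dist x y powr (real CARD('n) + 2 * s)"
  have X: "?X \<epsilon> = (LINT y|lborel. indicator {y. dist x y > \<epsilon>} y * F y)" for \<epsilon>
    unfolding set_lebesgue_integral_def F_def by (intro Bochner_Integration.integral_cong) (auto simp: indicator_def)
  have "(?X \<longlongrightarrow> (LINT y|lborel. F y)) (at_right 0)"
    unfolding X
  proof (rule tendsto_at_right_sequentially[OF zero_less_one])
    fix r :: "nat \<Rightarrow> real" assume r: "\<And>n. 0 < r n" "r \<longlonglongrightarrow> 0"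
    show "(\<lambda>n. LINT y|lborel. indicator {y. r n < dist x y} y * F y) \<longlonglongrightarrow> (LINT y|lborel. F y)"
    proof (rule integral_dominated_convergence[OF _ _ G_int])
      show "AE y in lborel. (\<lambda>n. indicator {y. r n < dist x y} y * F y) \<longlonglongrightarrow> F y"
      proof (rule AE_I2)
        fix y
        show "(\<lambda>n. indicator {y. r n < dist x y} y * F y) \<longlonglongrightarrow> F y"
        proof (cases "y = x")
          case True
          then show ?thesis by (simp add: F_def)
        next
          case False
          then have "\<forall>\<^sub>F n in sequentially. r n < dist x y"
            by (intro order_tendstoD(2)[OF r(2)]) simp
          then show ?thesis
            by (intro tendsto_eventually) (auto elim!: eventually_mono simp: indicator_def)
        qed
      qed
      show "AE y in lborel. norm (indicator {y. r n < dist x y} y * F y) \<le> G y" for n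
        using FG by (intro AE_I2) (auto simp: indicator_def intro: order_trans[OF abs_ge_zero])
    qed measurable
  qed
  then have "Lim (at_right 0) ?X = (LINT y|lborel. F y)"
    by (intro tendsto_Lim) auto
  then show ?thesis unfolding regional_frac_laplacian_def F_def by simp
qed

lemma frac_laplacian_const_pos:
  assumes "0 < s" "s < 1"
  shows "frac_laplacian_const n s > 0"
  unfolding frac_laplacian_const_def using assms
  by (intro divide_pos_pos mult_pos_pos Gamma_real_pos) auto

text \<open>Upper bounds on the operator pass to limits of the centres, in particular to boundary points. The
  integrands change sign, so Fatou's lemma is applied after adding the dominating functions, which all
  have the same integral.\<close>

lemma jump_integral_le_limit:
  fixes v :: "'a::euclidean_space \<Rightarrow> real"
  assumes S[measurable]: "S \<in> sets borel" and meas: "(\<lambda>y. indicator S y * v y) \<in> borel_measurable borel"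
    and G: "integrable lborel (\<lambda>z::'a. min 1 (M * norm z powr b) / norm z powr p)"
    and M: "0 \<le> M" and bound: "\<And>x y. x \<in> T \<Longrightarrow> y \<in> S \<Longrightarrow> \<bar>v y - v x\<bar> \<le> min 1 (M * dist x y powr b)"
    and X: "\<And>j. X j \<in> T" "X \<longlonglongrightarrow> x" "x \<in> T" "(\<lambda>j. v (X j)) \<longlonglongrightarrow> v x"
    and le: "\<And>j. (LINT y|lborel. indicator S y * ((v y - v (X j)) / dist (X j) y powr p)) \<le> g j"
    and g: "g \<longlonglongrightarrow> g0"
  shows "(LINT y|lborel. indicator S y * ((v y - v x) / dist x y powr p)) \<le> g0"
proof -
  define F where "F = (\<lambda>x y. indicator S y * ((v y - v x) / dist x y powr p))"
  define H where "H = (\<lambda>x y::'a. min 1 (M * dist x y powr b) / dist x y powr p)"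
  define A where "A = (LINT z|lborel. min 1 (M * norm (z::'a) powr b) / norm z powr p)"
  note jump = integrable_jump_integrand[OF S meas G M bound]
  have H: "integrable lborel (H x)" "(LINT y|lborel. H x y) = A" if "x \<in> T" for x
    unfolding H_def A_def using jump(2,3)[OF that] by auto
  have F: "integrable lborel (F x)" "F x \<in> borel_measurable borel" "\<And>y. \<bar>F x y\<bar> \<le> H x y" if "x \<in> T" for x
    unfolding H_def F_def using jump(1,4,5)[OF that] by auto
  have nonneg: "0 \<le> F x y + H x y" if "x \<in> T" for x y using F(3)[OF that, of y] by linarith
  have nn: "(\<integral>\<^sup>+y. ennreal (F x y + H x y) \<partial>lborel) = ennreal ((LINT y|lborel. F x y) + A)" if "x \<in> T" for x
    using F(1)[OF that] H[OF that] nonneg[OF that] by (subst nn_integral_eq_integral) auto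
  have pos: "0 \<le> (LINT y|lborel. F x y) + A" if "x \<in> T" for x
  proof -
    have "0 \<le> (LINT y|lborel. F x y + H x y)" using nonneg[OF that] by (intro integral_nonneg_AE) auto
    then show ?thesis using F(1)[OF that] H[OF that] by simp
  qed
  have lim: "(\<lambda>j. ennreal (F (X j) y + H (X j) y)) \<longlonglongrightarrow> ennreal (F x y + H x y)" if "y \<noteq> x" for y
  proof -
    have "(\<lambda>j. dist (X j) y) \<longlonglongrightarrow> dist x y" by (intro tendsto_intros X)
    then show ?thesis unfolding F_def H_def
      using that by (intro tendsto_intros X) auto
  qed
  have "(\<integral>\<^sup>+y. ennreal (F x y + H x y) \<partial>lborel)
      = (\<integral>\<^sup>+y. liminf (\<lambda>j. ennreal (F (X j) y + H (X j) y)) \<partial>lborel)"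
  proof (rule nn_integral_cong_AE)
    have "AE y in lborel. y \<noteq> x" by (rule AE_lborel_singleton)
    then show "AE y in lborel. ennreal (F x y + H x y) = liminf (\<lambda>j. ennreal (F (X j) y + H (X j) y))"
    proof eventually_elim
      case (elim y)
      show ?case using lim_imp_Liminf[OF sequentially_bot lim[OF elim]] by simp
    qed
  qed
  also have "\<dots> \<le> liminf (\<lambda>j. \<integral>\<^sup>+y. ennreal (F (X j) y + H (X j) y) \<partial>lborel)"
    using F(2)[OF X(1)] by (intro nn_integral_liminf) (simp add: H_def)
  also have "\<dots> = liminf (\<lambda>j. ennreal ((LINT y|lborel. F (X j) y) + A))"
    by (simp add: nn X)
  also have "\<dots> \<le> liminf (\<lambda>j. ennreal (g j + A))"
    by (intro Liminf_mono always_eventually allI ennreal_leI add_right_mono) (use le in \<open>simp add: F_def\<close>)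
  also have "\<dots> = ennreal (g0 + A)"
    by (intro lim_imp_Liminf tendsto_intros g) auto
  finally have "ennreal ((LINT y|lborel. F x y) + A) \<le> ennreal (g0 + A)" by (simp add: nn X)
  moreover have "0 \<le> g0 + A"
  proof (rule LIMSEQ_le_const)
    show "(\<lambda>j. g j + A) \<longlonglongrightarrow> g0 + A" by (intro tendsto_intros g)
    show "\<exists>N. \<forall>n\<ge>N. 0 \<le> g n + A"
      using pos[OF X(1)] le by (auto simp: F_def intro: order_trans[OF _ add_right_mono])
  qed
  ultimately show ?thesis by (simp add: F_def)
qed

section \<open>Level sets and half-spaces\<close>

text \<open>The point \<open>x\<close> maximizes the distance to \<open>C\<close> on the sublevel set. Beyond it \<open>v\<close> exceeds \<open>l\<close>; at equal
  distance \<open>v \<ge> l\<close> still holds, since walking off along a unit subgradient strictly increases the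
  distance and \<open>v\<close> is continuous. Applied to \<open>x\<close> itself this gives \<open>v x = l\<close>.\<close>

lemma last_point_below_level:
  fixes C T :: "'a::euclidean_space set" and v :: "'a \<Rightarrow> real"
  assumes C: "closed C" "convex C" "C \<noteq> {}" and T: "T \<inter> interior C = {}" "- C \<subseteq> T"
    and cont: "continuous_on T v"
    and sub: "compact {x \<in> T. v x \<le> l}" "{x \<in> T. v x \<le> l} \<noteq> {}"
  obtains t x e where "0 \<le> t" "x \<in> T" "v x = l" "norm e = 1"
    "\<And>z. (z - x) \<bullet> e \<le> infdist z C - t" "\<And>z. z \<in> T \<Longrightarrow> t \<le> infdist z C \<Longrightarrow> l \<le> v z"
proof -
  let ?D = "\<lambda>z. infdist z C"
  have "continuous_on {x \<in> T. v x \<le> l} ?D" by (intro continuous_intros)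
  then obtain x where x: "x \<in> T" "v x \<le> l" and max: "\<And>y. y \<in> T \<Longrightarrow> v y \<le> l \<Longrightarrow> ?D y \<le> ?D x"
    using continuous_attains_sup[OF sub] by blast
  have beyond: "l \<le> v z" if z: "z \<in> T" "?D x \<le> ?D z" for z
  proof -
    obtain e where e: "norm e = 1" "\<And>w. (w - z) \<bullet> e \<le> ?D w - ?D z"
      using infdist_unit_subgradient[OF C, of z] T(1) z(1) by blast
    define y where "y = (\<lambda>k. z + (1 / real (Suc k)) *\<^sub>R e)"
    have D: "?D z < ?D (y k)" for k
    proof -
      have "0 < (y k - z) \<bullet> e" using e(1) by (simp add: y_def power2_norm_eq_inner[symmetric])
      then show ?thesis using e(2)[of "y k"] by linarith
    qed
    have yT: "y k \<in> T" for k
    proof -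
      have "?D (y k) \<noteq> 0" using D[of k] infdist_nonneg[of z C] by linarith
      then show ?thesis using T(2) by auto
    qed
    have "l \<le> v (y k)" for k
      using max[OF yT, of k] D[of k] z(2) by linarith
    moreover have "(\<lambda>k. v (y k)) \<longlonglongrightarrow> v z"
    proof (rule continuous_on_tendsto_compose[OF cont])
      have "(\<lambda>k. 1 / real (Suc k)) \<longlonglongrightarrow> 0" by (rule LIMSEQ_Suc[OF lim_1_over_n])
      then have "y \<longlonglongrightarrow> z + 0 *\<^sub>R e" unfolding y_def by (intro tendsto_intros)
      then show "y \<longlonglongrightarrow> z" by simp
    qed (use z yT in auto)
    ultimately show ?thesis by (intro LIMSEQ_le_const) auto
  qed
  obtain e where e: "norm e = 1" "\<And>w. (w - x) \<bullet> e \<le> ?D w - ?D x"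
    using infdist_unit_subgradient[OF C, of x] T(1) x(1) by blast
  show thesis
    by (rule that[of "?D x" x e]) (use x e beyond[of x] beyond in \<open>auto intro: antisym infdist_nonneg\<close>)
qed

text \<open>The layer-cake decomposition of \<open>v - l\<close>. The positive part of the jump integral is the integral
  over \<open>k\<close> in \<open>(l, 1)\<close> of the kernel mass of the set \<open>v \<ge> k\<close>, which contains the half-space at
  distance \<open>t k - t l\<close> ahead of \<open>x\<close>. The negative part is the integral over \<open>k\<close> in \<open>(m, l)\<close> of the
  mass of \<open>v < k\<close>, which is contained in the half-space at distance \<open>t l - t k\<close> behind \<open>x\<close>. The
  constant \<open>c\<close> allows the inequality to be stated in \<open>ennreal\<close>, although \<open>a\<close> may be negative.\<close>

lemma jump_integral_level_bound:
  fixes v :: "'a::euclidean_space \<Rightarrow> real" and D :: "'a \<Rightarrow> real" and t :: "real \<Rightarrow> real"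
  assumes S[measurable]: "S \<in> sets borel" and meas: "(\<lambda>y. indicator S y * v y) \<in> borel_measurable borel"
    and int: "integrable lborel (\<lambda>y. indicator S y * ((v y - l) / dist x y powr p))"
    and range: "\<And>y. y \<in> S \<Longrightarrow> m \<le> v y \<and> v y \<le> 1"
    and e: "\<And>z. (z - x) \<bullet> e \<le> D z - t l"
    and pos: "\<And>z. 0 < D z \<Longrightarrow> z \<in> S"
    and l: "m < l" "l < 1"
    and t0: "0 \<le> t l" and mono: "\<And>k. l < k \<Longrightarrow> k < 1 \<Longrightarrow> t l < t k"
    and above: "\<And>k z. m < k \<Longrightarrow> k < 1 \<Longrightarrow> z \<in> S \<Longrightarrow> t k \<le> D z \<Longrightarrow> k \<le> v z"
    and le: "(LINT y|lborel. indicator S y * ((v y - l) / dist x y powr p)) \<le> - a"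
    and c: "0 \<le> c" "0 \<le> a + c"
  shows "(\<integral>\<^sup>+k. (if l < k \<and> k < 1 then halfspace_mass p (t k - t l) e else 0) \<partial>lborel) + ennreal (a + c)
     \<le> (\<integral>\<^sup>+k. (if m < k \<and> k < l then halfspace_mass p (t l - t k) (- e) else 0) \<partial>lborel) + ennreal c"
proof -
  define F where "F = (\<lambda>y. indicator S y * ((v y - l) / dist x y powr p))"
  define w where "w = (\<lambda>y. indicator S y * v y)"
  have [measurable]: "w \<in> borel_measurable borel" using meas by (simp add: w_def)
  have wv: "w y = v y" if "y \<in> S" for y using that by (simp add: w_def)
  define \<kappa> where "\<kappa> = (\<lambda>y. ennreal (1 / norm (y - x) powr p))"
  have [measurable]: "\<kappa> \<in> borel_measurable borel" unfolding \<kappa>_def by measurable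
  have F\<kappa>: "ennreal (F y) = indicator S y * (ennreal (v y - l) * \<kappa> y)"
    "ennreal (- F y) = indicator S y * (ennreal (l - v y) * \<kappa> y)" for y
  proof -
    have "F y = indicator S y * ((v y - l) * (1 / norm (y - x) powr p))"
         "- F y = indicator S y * ((l - v y) * (1 / norm (y - x) powr p))"
      by (simp_all add: F_def dist_norm norm_minus_commute indicator_def diff_divide_distrib)
    then show "ennreal (F y) = indicator S y * (ennreal (v y - l) * \<kappa> y)"
      "ennreal (- F y) = indicator S y * (ennreal (l - v y) * \<kappa> y)"
      unfolding \<kappa>_def by (cases "y \<in> S"; simp add: ennreal_mult''[symmetric])+
  qed
  \<comment> \<open>the levels above \<open>l\<close>\<close>
  have "(\<integral>\<^sup>+k. (if l < k \<and> k < 1 then halfspace_mass p (t k - t l) e else 0) \<partial>lborel)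
     \<le> (\<integral>\<^sup>+k. \<integral>\<^sup>+y. (if l < k \<and> k < 1 \<and> y \<in> S \<and> k \<le> w y then \<kappa> y else 0) \<partial>lborel \<partial>lborel)"
  proof (rule nn_integral_mono)
    fix k
    show "(if l < k \<and> k < 1 then halfspace_mass p (t k - t l) e else 0)
      \<le> (\<integral>\<^sup>+y. (if l < k \<and> k < 1 \<and> y \<in> S \<and> k \<le> w y then \<kappa> y else 0) \<partial>lborel)"
    proof (cases "l < k \<and> k < 1")
      case True
      have "halfspace_mass p (t k - t l) e
          = (\<integral>\<^sup>+y. \<kappa> y * indicator {z. t k - t l \<le> z \<bullet> e} (y - x) \<partial>lborel)"
        unfolding halfspace_mass_def \<kappa>_def by (rule nn_integral_lborel_translate_minus[symmetric]) measurable
      also have "\<dots> \<le> (\<integral>\<^sup>+y. (if l < k \<and> k < 1 \<and> y \<in> S \<and> k \<le> w y then \<kappa> y else 0) \<partial>lborel)"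
      proof (rule nn_integral_mono)
        fix y
        have "y \<in> S \<and> k \<le> w y" if "t k - t l \<le> (y - x) \<bullet> e"
        proof -
          have "t k \<le> D y" using that e[of y] by linarith
          moreover have "0 < t k" using mono[of k] True t0 by linarith
          ultimately have "y \<in> S" by (intro pos) linarith
          then show ?thesis using above[of k y] \<open>t k \<le> D y\<close> True l by (simp add: wv)
        qed
        then show "\<kappa> y * indicator {z. t k - t l \<le> z \<bullet> e} (y - x)
           \<le> (if l < k \<and> k < 1 \<and> y \<in> S \<and> k \<le> w y then \<kappa> y else 0)"
          using True by (auto simp: indicator_def)
      qed
      finally show ?thesis using True by simp
    qed auto
  qed
  also have "\<dots> = (\<integral>\<^sup>+y. \<integral>\<^sup>+k. (if l < k \<and> k < 1 \<and> y \<in> S \<and> k \<le> w y then \<kappa> y else 0) \<partial>lborel \<partial>lborel)"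
    by (rule lborel_pair.Fubini') measurable
  also have "\<dots> \<le> (\<integral>\<^sup>+y. ennreal (F y) \<partial>lborel)"
  proof (rule nn_integral_mono)
    fix y
    have "(\<integral>\<^sup>+k. (if l < k \<and> k < 1 \<and> y \<in> S \<and> k \<le> w y then \<kappa> y else 0) \<partial>lborel)
      \<le> (\<integral>\<^sup>+k. indicator S y * \<kappa> y * indicator {l..w y} k \<partial>lborel)"
      by (rule nn_integral_mono) (auto simp: indicator_def)
    also have "\<dots> = indicator S y * \<kappa> y * emeasure lborel {l..w y}"
      by (rule nn_integral_cmult_indicator) simp
    also have "\<dots> = ennreal (F y)"
      by (cases "l \<le> w y"; cases "y \<in> S") (auto simp: F\<kappa> wv mult.commute ennreal_neg)
    finally show "(\<integral>\<^sup>+k. (if l < k \<and> k < 1 \<and> y \<in> S \<and> k \<le> w y then \<kappa> y else 0) \<partial>lborel) \<le> ennreal (F y)" .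
  qed
  finally have P: "(\<integral>\<^sup>+k. (if l < k \<and> k < 1 then halfspace_mass p (t k - t l) e else 0) \<partial>lborel)
     \<le> (\<integral>\<^sup>+y. ennreal (F y) \<partial>lborel)" .
  \<comment> \<open>the levels below \<open>l\<close>\<close>
  have "(\<integral>\<^sup>+y. ennreal (- F y) \<partial>lborel)
     \<le> (\<integral>\<^sup>+y. \<integral>\<^sup>+k. (if m < k \<and> k < l \<and> y \<in> S \<and> w y < k then \<kappa> y else 0) \<partial>lborel \<partial>lborel)"
  proof (rule nn_integral_mono)
    fix y
    have "ennreal (- F y) = indicator S y * \<kappa> y * emeasure lborel {w y<..<l}"
      by (cases "w y \<le> l"; cases "y \<in> S") (auto simp: F\<kappa> wv mult.commute ennreal_neg)
    also have "\<dots> = (\<integral>\<^sup>+k. indicator S y * \<kappa> y * indicator {w y<..<l} k \<partial>lborel)"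
      by (rule nn_integral_cmult_indicator[symmetric]) simp
    also have "\<dots> \<le> (\<integral>\<^sup>+k. (if m < k \<and> k < l \<and> y \<in> S \<and> w y < k then \<kappa> y else 0) \<partial>lborel)"
      by (rule nn_integral_mono) (use range[of y] wv[of y] in \<open>auto simp: indicator_def\<close>)
    finally show "ennreal (- F y) \<le> (\<integral>\<^sup>+k. (if m < k \<and> k < l \<and> y \<in> S \<and> w y < k then \<kappa> y else 0) \<partial>lborel)" .
  qed
  also have "\<dots> = (\<integral>\<^sup>+k. \<integral>\<^sup>+y. (if m < k \<and> k < l \<and> y \<in> S \<and> w y < k then \<kappa> y else 0) \<partial>lborel \<partial>lborel)"
    by (rule lborel_pair.Fubini') measurable
  also have "\<dots> \<le> (\<integral>\<^sup>+k. (if m < k \<and> k < l then halfspace_mass p (t l - t k) (- e) else 0) \<partial>lborel)"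
  proof (rule nn_integral_mono)
    fix k
    show "(\<integral>\<^sup>+y. (if m < k \<and> k < l \<and> y \<in> S \<and> w y < k then \<kappa> y else 0) \<partial>lborel)
      \<le> (if m < k \<and> k < l then halfspace_mass p (t l - t k) (- e) else 0)"
    proof (cases "m < k \<and> k < l")
      case True
      have "(\<integral>\<^sup>+y. (if m < k \<and> k < l \<and> y \<in> S \<and> w y < k then \<kappa> y else 0) \<partial>lborel)
         \<le> (\<integral>\<^sup>+y. \<kappa> y * indicator {z. t l - t k \<le> z \<bullet> - e} (y - x) \<partial>lborel)"
      proof (rule nn_integral_mono)
        fix y
        have "t l - t k \<le> (y - x) \<bullet> - e" if "y \<in> S" "w y < k"
        proof -
          have "D y < t k" using above[of k y] that True l by (fastforce simp: wv)
          then show ?thesis using e[of y] by simp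
        qed
        then show "(if m < k \<and> k < l \<and> y \<in> S \<and> w y < k then \<kappa> y else 0)
          \<le> \<kappa> y * indicator {z. t l - t k \<le> z \<bullet> - e} (y - x)"
          by (auto simp: indicator_def)
      qed
      also have "\<dots> = halfspace_mass p (t l - t k) (- e)"
        unfolding halfspace_mass_def \<kappa>_def by (rule nn_integral_lborel_translate_minus) measurable
      finally show ?thesis using True by simp
    next
      case False
      then have "(\<lambda>y. if m < k \<and> k < l \<and> y \<in> S \<and> w y < k then \<kappa> y else 0) = (\<lambda>y. 0)" by auto
      then show ?thesis by simp
    qed
  qed
  finally have N: "(\<integral>\<^sup>+y. ennreal (- F y) \<partial>lborel) \<le>
    (\<integral>\<^sup>+k. (if m < k \<and> k < l then halfspace_mass p (t l - t k) (- e) else 0) \<partial>lborel)" .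
  have F: "integrable lborel F" using int by (simp add: F_def)
  define P' where "P' = enn2real (\<integral>\<^sup>+y. ennreal (F y) \<partial>lborel)"
  define N' where "N' = enn2real (\<integral>\<^sup>+y. ennreal (- F y) \<partial>lborel)"
  have fin: "(\<integral>\<^sup>+y. ennreal (F y) \<partial>lborel) = ennreal P'" "(\<integral>\<^sup>+y. ennreal (- F y) \<partial>lborel) = ennreal N'"
    using F unfolding P'_def N'_def by (auto simp: real_integrable_def less_top)
  have "P' - N' \<le> - a"
    using le real_lebesgue_integral_def[OF F] unfolding F_def[symmetric] P'_def N'_def by linarith
  moreover have "0 \<le> P'" "0 \<le> N'" by (simp_all add: P'_def N'_def)
  ultimately have "ennreal P' + ennreal (a + c) \<le> ennreal N' + ennreal c"
    using c by (simp add: ennreal_plus[symmetric] ennreal_leI del: ennreal_plus)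
  then show ?thesis
    using P N unfolding fin by (meson add_right_mono order_trans)
qed

section \<open>Balance of the fluxes\<close>

lemma nn_integral_powr_shift:
  fixes l g :: real
  assumes "0 \<le> g" "g < 1" "0 \<le> l"
  shows "(\<integral>\<^sup>+k. (if l < k \<and> k < 1 then ennreal ((k - l) powr - g) else 0) \<partial>lborel) \<le> ennreal (1 / (1 - g))"
proof -
  have "((\<lambda>x. x powr - g) has_integral (1 powr (- g + 1) / (- g + 1))) {0..1}"
    using assms by (intro has_integral_powr_from_0) auto
  then have "(\<integral>\<^sup>+x. indicator {0..1} x * ennreal (x powr - g) \<partial>lborel) = ennreal (1 / (1 - g))"
    using nn_integral_has_integral_lebesgue[of "{0..1}" "\<lambda>x. x powr - g"]
    by (simp add: ennreal_mult'' ennreal_indicator)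
  moreover have "(\<integral>\<^sup>+k. (if l < k \<and> k < 1 then ennreal ((k - l) powr - g) else 0) \<partial>lborel)
     \<le> (\<integral>\<^sup>+k. indicator {0..1} (k - l) * ennreal ((k - l) powr - g) \<partial>lborel)"
    using assms by (intro nn_integral_mono) (auto simp: indicator_def)
  moreover have "\<dots> = (\<integral>\<^sup>+k. indicator {0..1} k * ennreal (k powr - g) \<partial>lborel)"
    by (rule nn_integral_lborel_translate_minus[where h = "\<lambda>k. indicator {0..1} k * ennreal (k powr - g)"]) measurable
  ultimately show ?thesis by simp
qed

text \<open>Both sides integrate the same function of two levels, once over the larger and once over the
  smaller level first, so they agree by Tonelli's theorem. Finiteness, which is what permits cancelling them,
  uses \<open>b > 2 * s\<close>: the separation of levels makes the integrand at most a multiple of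
  \<open>(k - l) powr - g\<close> with \<open>g = 2 * s / b < 1\<close>.\<close>

lemma flux_balance:
  fixes t :: "real \<Rightarrow> real" and e :: "real ^ 'n" and m s b M :: real
  assumes m: "0 \<le> m" and e: "norm e = 1" and s: "0 < s" and b: "2 * s < b" and M: "0 < M"
    and holder: "\<And>l k. m < l \<Longrightarrow> l < k \<Longrightarrow> k < 1 \<Longrightarrow> t l < t k \<and> k - l \<le> M * (t k - t l) powr b"
  defines "H \<equiv> \<lambda>a. halfspace_mass (CARD('n) + 2 * s) a e"
  defines "P \<equiv> \<lambda>l. \<integral>\<^sup>+k. (if m < l \<and> l < k \<and> k < 1 then H (t k - t l) else 0) \<partial>lborel"
  defines "N \<equiv> \<lambda>l. \<integral>\<^sup>+k. (if m < k \<and> k < l \<and> l < 1 then H (t l - t k) else 0) \<partial>lborel"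
  shows "P \<in> borel_measurable lborel" "N \<in> borel_measurable lborel"
    and "(\<integral>\<^sup>+l. P l \<partial>lborel) = (\<integral>\<^sup>+l. N l \<partial>lborel)"
    and "(\<integral>\<^sup>+l. P l \<partial>lborel) < \<infinity>"
proof -
  \<comment> \<open>\<open>t\<close> is arbitrary outside the open interval, so it is cut off to be measurable\<close>
  define t' where "t' = (\<lambda>l. if m < l \<and> l < 1 then t l else 0)"
  have [measurable]: "t' \<in> borel_measurable borel"
  proof (rule borel_measurable_piecewise_mono[of "{{..m}, {m<..<1}, {1..}}"])
    show "mono_on c t'" if "c \<in> {{..m}, {m<..<1}, {1..}}" for c
    proof -
      have "t l \<le> t k" if "m < l" "l \<le> k" "k < 1" for l k
        using holder[of l k] that by (cases "l = k") auto
      then show ?thesis using that by (auto simp: t'_def intro!: mono_onI)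
    qed
    show "\<Union>{{..m}, {m<..<1}, {1..}} = UNIV" by auto
  qed auto
  have [measurable]: "H \<in> borel_measurable borel"
  proof -
    have "(\<lambda>a. \<integral>\<^sup>+z. (if a \<le> z \<bullet> e then ennreal (1 / norm z powr (CARD('n) + 2 * s)) else 0) \<partial>lborel)
       \<in> borel_measurable borel" by measurable
    moreover have "H = (\<lambda>a. \<integral>\<^sup>+z. (if a \<le> z \<bullet> e then ennreal (1 / norm z powr (CARD('n) + 2 * s)) else 0) \<partial>lborel)"
      unfolding H_def halfspace_mass_def by (intro ext nn_integral_cong) (simp add: indicator_def)
    ultimately show ?thesis by simp
  qed
  define Q where "Q = (\<lambda>l k. if m < l \<and> l < k \<and> k < 1 then H (t' k - t' l) else 0)"
  have Q[measurable]: "case_prod Q \<in> borel_measurable (borel \<Otimes>\<^sub>M borel)"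
    unfolding Q_def by measurable
  have P: "P = (\<lambda>l. \<integral>\<^sup>+k. Q l k \<partial>lborel)"
    unfolding P_def Q_def t'_def by (intro ext nn_integral_cong) auto
  have N: "N = (\<lambda>l. \<integral>\<^sup>+k. Q k l \<partial>lborel)"
    unfolding N_def Q_def t'_def by (intro ext nn_integral_cong) auto
  show "P \<in> borel_measurable lborel" unfolding P by measurable
  show "N \<in> borel_measurable lborel" unfolding N by measurable
  show "(\<integral>\<^sup>+l. P l \<partial>lborel) = (\<integral>\<^sup>+l. N l \<partial>lborel)"
    unfolding P N by (rule lborel_pair.Fubini') measurable
  obtain B where B: "B \<ge> 0" "\<And>a. a > 0 \<Longrightarrow> H a \<le> ennreal (B * a powr (- 2 * s))"
  proof -
    have dim: "CARD('n) + 2 * s > DIM(real ^ 'n)" using s by simp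
    obtain B where "B \<ge> 0"
      "\<And>a (e::real^'n). a > 0 \<Longrightarrow> norm e = 1 \<Longrightarrow> halfspace_mass (CARD('n) + 2 * s) a e
         \<le> ennreal (B * a powr (DIM(real ^ 'n) - (CARD('n) + 2 * s)))"
      by (rule halfspace_mass_le[OF dim]) (rule that, assumption, assumption)
    then show thesis using e by (intro that[of B]) (auto simp: H_def)
  qed
  define g where "g = 2 * s / b"
  have g: "0 \<le> g" "g < 1" using s b by (auto simp: g_def)
  have Qle: "Q l k \<le> ennreal (B * M powr g) * (if l < k \<and> k < 1 then ennreal ((k - l) powr - g) else 0)"
    if l: "m < l" for l k
  proof (cases "l < k \<and> k < 1")
    case True
    define \<tau> where "\<tau> = t k - t l"
    have \<tau>: "0 < \<tau>" "k - l \<le> M * \<tau> powr b" using holder[of l k] True l by (auto simp: \<tau>_def)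
    have "(M * \<tau> powr b) powr - g \<le> (k - l) powr - g"
      using \<tau> True g by (intro powr_mono2') auto
    then have "M powr - g * \<tau> powr (- 2 * s) \<le> (k - l) powr - g"
      using M \<tau> s b by (simp add: powr_mult powr_powr g_def)
    then have "M powr g * (M powr - g * \<tau> powr (- 2 * s)) \<le> M powr g * (k - l) powr - g"
      by (rule mult_left_mono) simp
    moreover have "M powr g * M powr - g = 1" using M by (simp flip: powr_add)
    ultimately have "\<tau> powr (- 2 * s) \<le> M powr g * (k - l) powr - g"
      by (simp add: mult.assoc[symmetric])
    then have "B * \<tau> powr (- 2 * s) \<le> B * M powr g * (k - l) powr - g"
      using B(1) by (simp add: mult_left_mono mult.assoc)
    then have "ennreal (B * \<tau> powr (- 2 * s)) \<le> ennreal (B * M powr g) * ennreal ((k - l) powr - g)"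
      using B(1) by (simp add: ennreal_mult'[symmetric] ennreal_leI)
    moreover have "Q l k = H \<tau>" using True l by (simp add: Q_def t'_def \<tau>_def)
    ultimately show ?thesis using B(2)[OF \<tau>(1)] True by (auto intro: order_trans)
  qed (auto simp: Q_def)
  have "(\<integral>\<^sup>+l. P l \<partial>lborel) \<le> (\<integral>\<^sup>+l. ennreal (B * M powr g) * ennreal (1 / (1 - g)) * indicator {m<..<1} l \<partial>lborel)"
  proof (rule nn_integral_mono)
    fix l
    show "P l \<le> ennreal (B * M powr g) * ennreal (1 / (1 - g)) * indicator {m<..<1} l"
    proof (cases "m < l \<and> l < 1")
      case True
      have "P l \<le> (\<integral>\<^sup>+k. ennreal (B * M powr g) * (if l < k \<and> k < 1 then ennreal ((k - l) powr - g) else 0) \<partial>lborel)"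
        unfolding P by (intro nn_integral_mono Qle) (use True in auto)
      also have "\<dots> = ennreal (B * M powr g) * (\<integral>\<^sup>+k. (if l < k \<and> k < 1 then ennreal ((k - l) powr - g) else 0) \<partial>lborel)"
        by (rule nn_integral_cmult) measurable
      also have "\<dots> \<le> ennreal (B * M powr g) * ennreal (1 / (1 - g))"
        by (intro mult_left_mono nn_integral_powr_shift) (use g True m in auto)
      finally show ?thesis using True by simp
    next
      case False
      then have "Q l = (\<lambda>k. 0)" by (intro ext) (auto simp: Q_def)
      then show ?thesis by (simp add: P)
    qed
  qed
  also have "\<dots> = ennreal (B * M powr g) * ennreal (1 / (1 - g)) * emeasure lborel {m<..<1}"
    by (rule nn_integral_cmult_indicator) simp
  also have "\<dots> < \<infinity>"
    by (cases "m \<le> 1") (auto simp: ennreal_mult_less_top)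
  finally show "(\<integral>\<^sup>+l. P l \<partial>lborel) < \<infinity>" .
qed

text \<open>For \<open>m \<le> \<theta>\<close> the piece of the integral that is cut off is at most \<open>0\<close>; for \<open>m > \<theta>\<close> the
  integrand is positive.\<close>

lemma bistable_integral_pos:
  fixes f :: "real \<Rightarrow> real"
  assumes cont: "continuous_on {0..1} f" and \<theta>: "0 < \<theta>" "\<theta> < 1"
    and neg: "\<And>t. t \<in> {0<..<\<theta>} \<Longrightarrow> f t < 0" and pos: "\<And>t. t \<in> {\<theta><..<1} \<Longrightarrow> f t > 0"
    and zeros: "f 0 = 0" "f \<theta> = 0" "f 1 = 0"
    and int: "integral {0..1} f > 0" and m: "0 \<le> m" "m < 1"
  shows "integral {m..1} f > 0"
proof (cases "m \<le> \<theta>")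
  case True
  have on: "f integrable_on {0..1}" by (rule integrable_continuous_real[OF cont])
  have "integral {0..m} f \<le> integral {0..m} (\<lambda>_. 0)"
  proof (rule integral_le)
    show "f integrable_on {0..m}"
      by (rule integrable_on_subinterval[OF on]) (use m in auto)
    fix x assume "x \<in> {0..m}"
    then show "f x \<le> 0" using neg[of x] zeros True by (cases "x = 0"; cases "x = \<theta>") auto
  qed (rule integrable_0)
  moreover have "integral {0..m} f + integral {m..1} f = integral {0..1} f"
    using m by (intro Henstock_Kurzweil_Integration.integral_combine on) auto
  ultimately show ?thesis using int by simp
next
  case False
  have c: "continuous_on {m..1} f" by (rule continuous_on_subset[OF cont]) (use m in auto)
  have nn: "0 \<le> f x" if "x \<in> {m..1}" for x
    using pos[of x] zeros False that by (cases "x = 1") auto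
  have "0 \<le> integral {m..1} f"
    by (rule Henstock_Kurzweil_Integration.integral_nonneg[OF integrable_continuous_real[OF c] nn])
  moreover have "integral {m..1} f \<noteq> 0"
  proof
    assume "integral {m..1} f = 0"
    then have "\<forall>x\<in>{m..1}. f x = 0" using integral_eq_0_iff[OF c m(2) nn] by simp
    moreover have "f m > 0" using pos[of m] False m by auto
    ultimately show False using m by auto
  qed
  ultimately show ?thesis by simp
qed

section \<open>Preparation of the supersolution\<close>

lemma holder_closure_extension:
  fixes u :: "'a::metric_space \<Rightarrow> real"
  assumes b: "0 < b" and M: "0 \<le> M"
    and holder: "\<And>x y. x \<in> S \<Longrightarrow> y \<in> S \<Longrightarrow> \<bar>u x - u y\<bar> \<le> M * dist x y powr b"
    and range: "\<And>x. x \<in> S \<Longrightarrow> 0 \<le> u x \<and> u x \<le> 1"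
  obtains v where "continuous_on (closure S) v" "\<And>x. x \<in> S \<Longrightarrow> v x = u x"
    "\<And>x. x \<in> closure S \<Longrightarrow> 0 \<le> v x \<and> v x \<le> 1"
    "\<And>x y. x \<in> closure S \<Longrightarrow> y \<in> closure S \<Longrightarrow> \<bar>v x - v y\<bar> \<le> M * dist x y powr b"
proof -
  have "uniformly_continuous_on S u"
    unfolding uniformly_continuous_on_def
  proof (intro allI impI)
    fix \<epsilon> :: real assume \<epsilon>: "0 < \<epsilon>"
    define d where "d = (\<epsilon> / (M + 1)) powr (1 / b)"
    have d: "0 < d" using \<epsilon> M by (simp add: d_def)
    show "\<exists>d>0. \<forall>x\<in>S. \<forall>x'\<in>S. dist x' x < d \<longrightarrow> dist (u x') (u x) < \<epsilon>"
    proof (intro exI[of _ d] conjI d ballI impI)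
      fix x x' assume x: "x \<in> S" "x' \<in> S" "dist x' x < d"
      have "\<bar>u x' - u x\<bar> \<le> M * dist x' x powr b" using holder x by blast
      also have "\<dots> \<le> M * d powr b"
        using x b M by (intro mult_left_mono powr_mono2) auto
      also have "d powr b = \<epsilon> / (M + 1)" using b \<epsilon> M by (simp add: d_def powr_powr)
      also have "M * (\<epsilon> / (M + 1)) < \<epsilon>" using M \<epsilon> by (simp add: field_simps)
      finally show "dist (u x') (u x) < \<epsilon>" by (simp add: dist_real_def)
    qed
  qed
  then obtain v where v: "uniformly_continuous_on (closure S) v" "\<And>x. x \<in> S \<Longrightarrow> u x = v x"
    using uniformly_continuous_on_extension_on_closure by metis
  then have cont: "continuous_on (closure S) v" by (simp add: uniformly_continuous_imp_continuous)
  have lim: "(\<lambda>n. v (X n)) \<longlonglongrightarrow> v x" if "\<And>n. X n \<in> S" "X \<longlonglongrightarrow> x" "x \<in> closure S" for X x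
    using that closure_subset by (intro continuous_on_tendsto_compose[OF cont]) (auto intro!: always_eventually)
  show thesis
  proof (rule that[OF cont])
    show "v x = u x" if "x \<in> S" for x using v(2) that by simp
    show "0 \<le> v x \<and> v x \<le> 1" if x: "x \<in> closure S" for x
    proof -
      obtain X where X: "\<And>n. X n \<in> S" "X \<longlonglongrightarrow> x" using x closure_sequential by metis
      have r: "0 \<le> v (X n)" "v (X n) \<le> 1" for n using range[OF X(1)] v(2)[OF X(1)] by auto
      show ?thesis
        using LIMSEQ_le_const[OF lim[OF X x], of 0] LIMSEQ_le_const2[OF lim[OF X x], of 1] r by blast
    qed
    show "\<bar>v x - v y\<bar> \<le> M * dist x y powr b" if x: "x \<in> closure S" and y: "y \<in> closure S" for x y
    proof (cases "x = y")
      case False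
      obtain X where X: "\<And>n. X n \<in> S" "X \<longlonglongrightarrow> x" using x closure_sequential by metis
      obtain Y where Y: "\<And>n. Y n \<in> S" "Y \<longlonglongrightarrow> y" using y closure_sequential by metis
      show ?thesis
      proof (rule LIMSEQ_le)
        show "(\<lambda>n. \<bar>v (X n) - v (Y n)\<bar>) \<longlonglongrightarrow> \<bar>v x - v y\<bar>"
          by (intro tendsto_intros lim X Y x y)
        show "(\<lambda>n. M * dist (X n) (Y n) powr b) \<longlonglongrightarrow> M * dist x y powr b"
          using False by (intro tendsto_intros X Y) auto
        show "\<exists>N. \<forall>n\<ge>N. \<bar>v (X n) - v (Y n)\<bar> \<le> M * dist (X n) (Y n) powr b"
          using holder[OF X(1) Y(1)] v(2)[OF X(1)] v(2)[OF Y(1)] by auto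
      qed
    qed simp
  qed
qed

text \<open>Far apart, the values in the unit interval differ by at most \<open>1\<close>. This allows the Hoelder exponent to
  be taken at most \<open>1\<close>, which keeps it below the exponent of the kernel.\<close>

lemma holder_on_smaller_exponent:
  fixes u :: "'a::metric_space \<Rightarrow> real"
  assumes "holder_on \<beta> S u" "0 < b" "b \<le> \<beta>" and range: "\<And>x. x \<in> S \<Longrightarrow> u x \<in> {0..1}"
  obtains M where "0 < M" "\<And>x y. x \<in> S \<Longrightarrow> y \<in> S \<Longrightarrow> \<bar>u x - u y\<bar> \<le> M * dist x y powr b"
proof -
  obtain M where M: "\<And>x y. x \<in> S \<Longrightarrow> y \<in> S \<Longrightarrow> \<bar>u x - u y\<bar> \<le> M * dist x y powr \<beta>"
    using assms(1) unfolding holder_on_def by blast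
  have "\<bar>u x - u y\<bar> \<le> max M 1 * dist x y powr b" if x: "x \<in> S" "y \<in> S" for x y
  proof (cases "dist x y \<le> 1")
    case True
    have "\<bar>u x - u y\<bar> \<le> M * dist x y powr \<beta>" using M x by blast
    also have "\<dots> \<le> max M 1 * dist x y powr \<beta>" by (intro mult_right_mono) auto
    also have "\<dots> \<le> max M 1 * dist x y powr b"
      using True assms by (intro mult_left_mono powr_mono') auto
    finally show ?thesis .
  next
    case False
    then have "1 \<le> dist x y powr b" using assms by (intro ge_one_powr_ge_zero) auto
    then have "1 * 1 \<le> max M 1 * dist x y powr b" by (intro mult_mono) auto
    then show ?thesis using range[OF x(1)] range[OF x(2)] by auto
  qed
  then show thesis by (intro that[of "max M 1"]) auto
qed

lemma compact_sublevel:
  fixes v u :: "'a::euclidean_space \<Rightarrow> real"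
  assumes cont: "continuous_on (closure (- K)) v" and vu: "\<And>x. x \<notin> K \<Longrightarrow> v x = u x"
    and K: "bounded K" and lim: "(u \<longlongrightarrow> 1) at_infinity" and l: "l < 1"
  shows "compact {x \<in> closure (- K). v x \<le> l}"
  unfolding compact_eq_bounded_closed
proof
  have "closed (closure (- K) \<inter> v -` {..l})"
    by (rule continuous_closed_preimage[OF cont]) auto
  also have "closure (- K) \<inter> v -` {..l} = {x \<in> closure (- K). v x \<le> l}" by auto
  finally show "closed {x \<in> closure (- K). v x \<le> l}" .
  obtain R where R: "\<And>x. R \<le> norm x \<Longrightarrow> l < u x"
    using order_tendstoD(1)[OF lim l] unfolding eventually_at_infinity by blast
  obtain R' where R': "\<And>x. x \<in> K \<Longrightarrow> norm x \<le> R'"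
    using K unfolding bounded_iff by blast
  show "bounded {x \<in> closure (- K). v x \<le> l}"
    unfolding bounded_iff
  proof (intro exI[of _ "max R R'"] ballI)
    fix x assume x: "x \<in> {x \<in> closure (- K). v x \<le> l}"
    show "norm x \<le> max R R'"
    proof (cases "x \<in> K")
      case True then show ?thesis using R'[of x] by simp
    next
      case False
      then show ?thesis using R[of x] vu[of x] x by fastforce
    qed
  qed
qed

section \<open>The Liouville theorem\<close>

theorem theorem2p2:
  fixes K :: "(real ^ 'n) set"
    and u :: "real ^ 'n \<Rightarrow> real"
    and f f' :: "real \<Rightarrow> real"
    and s \<theta> \<beta> :: real
  assumes n_ge_2: "CARD('n) \<ge> 2"
    and s: "0 < s" "s < 1 / 2"
    and K: "compact K" "convex K" "lipschitz_boundary K"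
    and f_C1: "\<And>t. t \<in> {0..1} \<Longrightarrow> (f has_real_derivative f' t) (at t within {0..1})"
      "continuous_on {0..1} f'"
    and \<theta>: "0 < \<theta>" "\<theta> < 1"
    and f_zeros: "f 0 = 0" "f \<theta> = 0" "f 1 = 0"
    and f_neg: "\<And>t. t \<in> {0<..<\<theta>} \<Longrightarrow> f t < 0"
    and f_pos: "\<And>t. t \<in> {\<theta><..<1} \<Longrightarrow> f t > 0"
    and f_int: "integral {0..1} f > 0"
    and f'_signs: "f' 0 < 0" "f' \<theta> > 0" "f' 1 < 0"
    and \<beta>: "\<beta> > 2 * s"
    and u_range: "\<And>x. x \<notin> K \<Longrightarrow> u x \<in> {0..1}"
    and u_holder: "holder_on \<beta> (- K) u"
    and u_super: "\<And>x. x \<notin> K \<Longrightarrow> regional_frac_laplacian s K u x + f (u x) \<le> 0"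
    and u_lim: "(u \<longlongrightarrow> 1) at_infinity"
  shows "\<forall>x \<in> closure (- K). closure_extension (- K) u x = 1"
proof -
  define p where "p = CARD('n) + 2 * s"
  define b where "b = min \<beta> 1"
  define T where "T = closure (- K)"
  define \<gamma> where "\<gamma> = frac_laplacian_const CARD('n) s"
  have \<gamma>: "0 < \<gamma>" unfolding \<gamma>_def using s by (intro frac_laplacian_const_pos) auto
  have b: "0 < b" "2 * s < b" "b \<le> 1" "b \<le> \<beta>" using s \<beta> by (auto simp: b_def)
  have ST: "- K \<subseteq> T" unfolding T_def by (rule closure_subset)
  have [measurable]: "K \<in> sets borel" using K(1) by (simp add: borel_compact)
  obtain M where M: "0 < M"
    "\<And>x y. x \<in> - K \<Longrightarrow> y \<in> - K \<Longrightarrow> \<bar>u x - u y\<bar> \<le> M * dist x y powr b"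
    by (rule holder_on_smaller_exponent[OF u_holder b(1,4)]) (use u_range in auto)
  obtain v where cont: "continuous_on T v" and vu: "\<And>x. x \<in> - K \<Longrightarrow> v x = u x"
    and v01: "\<And>x. x \<in> T \<Longrightarrow> 0 \<le> v x \<and> v x \<le> 1"
    and vhol: "\<And>x y. x \<in> T \<Longrightarrow> y \<in> T \<Longrightarrow> \<bar>v x - v y\<bar> \<le> M * dist x y powr b"
    unfolding T_def
    by (rule holder_closure_extension[of b M "- K" u]) (use b M u_range in auto)
  have bound: "\<bar>v y - v x\<bar> \<le> min 1 (M * dist x y powr b)" if "x \<in> T" "y \<in> - K" for x y
  proof -
    have "y \<in> T" using that ST by blast
    then show ?thesis
      using vhol[OF that(1), of y] v01[OF that(1)] v01[of y] by (simp add: abs_minus_commute abs_le_iff)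
  qed
  have S: "- K \<in> sets borel" by simp
  have meas: "(\<lambda>y. indicator (- K) y * v y) \<in> borel_measurable borel"
    using borel_measurable_continuous_on_indicator[OF S continuous_on_subset[OF cont ST]] by simp
  have G: "integrable lborel (\<lambda>z::real^'n. min 1 (M * norm z powr b) / norm z powr p)"
    by (rule integrable_holder_kernel) (use M s b n_ge_2 in \<open>auto simp: p_def\<close>)
  have f_cont: "continuous_on {0..1} f"
    using f_C1(1) by (meson DERIV_continuous continuous_on_eq_continuous_within)

  define J where "J = (\<lambda>x. LINT y|lborel. indicator (- K) y * ((v y - v x) / dist x y powr p))"
  have J_int: "J x \<le> - f (v x) / \<gamma>" if x: "x \<in> - K" for x
  proof -
    have bd: "\<bar>v y - v x\<bar> \<le> min 1 (M * dist x y powr b)" if "y \<notin> K" for y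
      using bound[of x y] x that ST by auto
    have "regional_frac_laplacian s K u x = regional_frac_laplacian s K v x"
      unfolding regional_frac_laplacian_def set_lebesgue_integral_def
      using x by (intro arg_cong2[where f = "(*)"] arg_cong2[where f = Lim] refl ext Bochner_Integration.integral_cong)
        (auto simp: vu split: split_indicator)
    also have "\<dots> = \<gamma> * J x"
      unfolding J_def p_def \<gamma>_def
      by (rule regional_frac_laplacian_eq[OF _ meas G[unfolded p_def] _ bd]) (use M in auto)
    finally have "\<gamma> * J x + f (v x) \<le> 0" using u_super[of x] vu[OF x] x by simp
    then show ?thesis using \<gamma> by (simp add: field_simps)
  qed
  \<comment> \<open>the same inequality at boundary points of \<open>K\<close>\<close>
  have J: "J x \<le> - f (v x) / \<gamma>" if x: "x \<in> T" for x
  proof -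
    obtain X where X: "\<And>j. X j \<in> - K" "X \<longlonglongrightarrow> x" using x closure_sequential unfolding T_def by metis
    have XT: "X j \<in> T" for j using X ST by auto
    have vX: "(\<lambda>j. v (X j)) \<longlonglongrightarrow> v x"
      by (rule continuous_on_tendsto_compose[OF cont X(2) x]) (simp add: XT)
    have fX: "(\<lambda>j. f (v (X j))) \<longlonglongrightarrow> f (v x)"
      by (rule continuous_on_tendsto_compose[OF f_cont vX]) (use v01 x XT in auto)
    show ?thesis
      unfolding J_def
    proof (rule jump_integral_le_limit[OF S meas G _ bound XT X(2) x vX])
      show "(LINT y|lborel. indicator (- K) y * ((v y - v (X j)) / dist (X j) y powr p)) \<le> - f (v (X j)) / \<gamma>" for j
        using J_int[OF X(1)] by (simp add: J_def)
      show "(\<lambda>j. - f (v (X j)) / \<gamma>) \<longlonglongrightarrow> - f (v x) / \<gamma>" using \<gamma> by (intro tendsto_intros fX) auto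
    qed (use M in auto)
  qed

  \<comment> \<open>\<open>infdist\<close> to the empty set is constantly \<open>0\<close>; for empty \<open>K\<close>, distances from the origin serve instead\<close>
  define C where "C = (if K = {} then {0} else K)"
  have C: "closed C" "convex C" "C \<noteq> {}" "K \<subseteq> C" "T \<inter> interior C = {}" "- C \<subseteq> T"
    using K ST by (auto simp: C_def T_def compact_imp_closed closure_complement)
  define D where "D = (\<lambda>z. infdist z C)"
  have D_pos: "z \<in> - K" if "0 < D z" for z
    using that C(4) by (auto simp: D_def)

  have "u x = 1" if x1: "x \<in> - K" for x
  proof (rule ccontr)
    assume "u x \<noteq> 1"
    then have vx: "v x < 1" "x \<in> T" using v01[of x] x1 ST vu by fastforce+
    define m where "m = Inf (v ` T)"
    have bdd: "bdd_below (v ` T)" using v01 by (intro bdd_belowI[of _ 0]) auto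
    have m_le: "m \<le> v y" if "y \<in> T" for y
      unfolding m_def using bdd that by (intro cInf_lower) auto
    have m: "0 \<le> m" "m < 1"
      using m_le[OF vx(2)] vx v01 unfolding m_def by (auto intro!: cInf_greatest)
    \<comment> \<open>\<open>x\<close> is a last point below level \<open>l\<close>, at distance \<open>t\<close>, with normal \<open>e\<close>\<close>
    define \<Phi> where "\<Phi> = (\<lambda>l t x e. 0 \<le> t \<and> x \<in> T \<and> v x = l \<and> norm e = 1 \<and>
        (\<forall>z. (z - x) \<bullet> e \<le> D z - t) \<and> (\<forall>z. z \<in> T \<longrightarrow> t \<le> D z \<longrightarrow> l \<le> v z))"
    have "\<exists>t x e. \<Phi> l t x e" if l: "m < l" "l < 1" for l
    proof -
      have "compact {x \<in> T. v x \<le> l}"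
        unfolding T_def
        by (rule compact_sublevel[OF cont[unfolded T_def] _ _ u_lim l(2)])
          (use vu K compact_imp_bounded in auto)
      moreover have "{x \<in> T. v x \<le> l} \<noteq> {}"
      proof -
        obtain y where "y \<in> v ` T" "y < l"
          using l(1) vx(2) bdd unfolding m_def by (subst (asm) cInf_less_iff) auto
        then show ?thesis by force
      qed
      ultimately show ?thesis
        by (rule last_point_below_level[OF C(1,2,3,5,6) cont]) (unfold \<Phi>_def D_def, blast)
    qed
    then obtain t X E where \<Phi>: "\<And>l. m < l \<Longrightarrow> l < 1 \<Longrightarrow> \<Phi> l (t l) (X l) (E l)"
      by metis
    have t0: "\<And>l. m < l \<Longrightarrow> l < 1 \<Longrightarrow> 0 \<le> t l"
      and XT: "\<And>l. m < l \<Longrightarrow> l < 1 \<Longrightarrow> X l \<in> T"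
      and vX: "\<And>l. m < l \<Longrightarrow> l < 1 \<Longrightarrow> v (X l) = l"
      and E1: "\<And>l. m < l \<Longrightarrow> l < 1 \<Longrightarrow> norm (E l) = 1"
      and E: "\<And>l z. m < l \<Longrightarrow> l < 1 \<Longrightarrow> (z - X l) \<bullet> E l \<le> D z - t l"
      and above: "\<And>l z. m < l \<Longrightarrow> l < 1 \<Longrightarrow> z \<in> T \<Longrightarrow> t l \<le> D z \<Longrightarrow> l \<le> v z"
      using \<Phi> unfolding \<Phi>_def by blast+
    \<comment> \<open>from \<open>X l\<close> the level \<open>k\<close> is reached after moving \<open>t k - t l\<close> along the normal\<close>
    have sep: "t l < t k \<and> k - l \<le> M * (t k - t l) powr b" if lk: "m < l" "l < k" "k < 1" for l k
    proof -
      have l: "m < l" "l < 1" and k: "m < k" "k < 1" using lk by auto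
      have less: "t l < t k"
      proof (rule ccontr)
        assume "\<not> t l < t k"
        then have "t k \<le> D (X l)" using E[OF l, of "X l"] by simp
        then show False using above[OF k XT[OF l]] vX[OF l] lk by simp
      qed
      define z where "z = X l + (t k - t l) *\<^sub>R E l"
      have "(z - X l) \<bullet> E l = t k - t l"
        using E1[OF l] by (simp add: z_def power2_norm_eq_inner[symmetric])
      then have Dz: "t k \<le> D z" using E[OF l, of z] by simp
      then have zT: "z \<in> T" using D_pos[of z] less t0[OF l] ST by auto
      have "k - l \<le> v z - v (X l)" using above[OF k zT Dz] vX[OF l] by simp
      also have "\<dots> \<le> M * dist z (X l) powr b" using vhol[OF zT XT[OF l]] by simp
      also have "dist z (X l) = t k - t l" using less E1[OF l] by (simp add: z_def dist_norm)
      finally show ?thesis using less by simp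
    qed
    obtain e :: "real ^ 'n" where e: "norm e = 1" using vector_choose_size[of 1] by auto
    define P where "P = (\<lambda>l. \<integral>\<^sup>+k. (if m < l \<and> l < k \<and> k < 1 then halfspace_mass p (t k - t l) e else 0) \<partial>lborel)"
    define N where "N = (\<lambda>l. \<integral>\<^sup>+k. (if m < k \<and> k < l \<and> l < 1 then halfspace_mass p (t l - t k) e else 0) \<partial>lborel)"
    have PN: "P \<in> borel_measurable lborel" "N \<in> borel_measurable lborel"
      "(\<integral>\<^sup>+l. P l \<partial>lborel) = (\<integral>\<^sup>+l. N l \<partial>lborel)" "(\<integral>\<^sup>+l. P l \<partial>lborel) < \<infinity>"
      unfolding P_def N_def p_def using flux_balance[OF m(1) e s(1) b(2) M(1) sep] by simp_all
    \<comment> \<open>a shift that makes \<open>f\<close> nonnegative, so that everything can be integrated in \<open>ennreal\<close>\<close>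
    obtain c where c: "0 \<le> c" "\<And>r. r \<in> {0..1} \<Longrightarrow> 0 \<le> f r + c"
    proof -
      have "compact (f ` {0..1})" by (intro compact_continuous_image f_cont) auto
      then obtain c where "\<And>r. r \<in> {0..1} \<Longrightarrow> \<bar>f r\<bar> \<le> c"
        using compact_imp_bounded bounded_iff by (metis image_eqI real_norm_def)
      then show thesis by (intro that[of "\<bar>c\<bar>"]) force+
    qed
    have level: "P l + indicator {m<..<1} l * ennreal ((f l + c) / \<gamma>)
        \<le> N l + indicator {m<..<1} l * ennreal (c / \<gamma>)" for l
    proof (cases "l \<in> {m<..<1}")
      case True
      then have l: "m < l" "l < 1" by auto
      have dir: "halfspace_mass p a (E l) = halfspace_mass p a e" "halfspace_mass p a (- E l) = halfspace_mass p a e" for a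
        using E1[OF l] e by (auto intro: halfspace_mass_direction)
      have "(\<integral>\<^sup>+k. (if l < k \<and> k < 1 then halfspace_mass p (t k - t l) (E l) else 0) \<partial>lborel) + ennreal (f l / \<gamma> + c / \<gamma>)
        \<le> (\<integral>\<^sup>+k. (if m < k \<and> k < l then halfspace_mass p (t l - t k) (- E l) else 0) \<partial>lborel) + ennreal (c / \<gamma>)"
      proof (rule jump_integral_level_bound[OF S meas, where x = "X l" and D = D])
        have "\<And>y. y \<in> - K \<Longrightarrow> \<bar>v y - v (X l)\<bar> \<le> min 1 (M * dist (X l) y powr b)"
          using bound XT[OF l] by blast
        from integrable_jump_integrand(1)[OF S meas G _ this]
        show "integrable lborel (\<lambda>y. indicator (- K) y * ((v y - l) / dist (X l) y powr p))"
          using M vX[OF l] by simp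
        show "(LINT y|lborel. indicator (- K) y * ((v y - l) / dist (X l) y powr p)) \<le> - (f l / \<gamma>)"
          using J[OF XT[OF l]] vX[OF l] by (simp add: J_def)
        show "m \<le> v y \<and> v y \<le> 1" if "y \<in> - K" for y using m_le v01 that ST by blast
        show "k \<le> v z" if "m < k" "k < 1" "z \<in> - K" "t k \<le> D z" for k z
          using above that ST by blast
        have "0 \<le> f l + c" using c(2) l m by auto
        then show "0 \<le> f l / \<gamma> + c / \<gamma>" using \<gamma> by (simp flip: add_divide_distrib)
      qed (use l E t0 sep D_pos c \<gamma> in auto)
      then show ?thesis using True l unfolding dir P_def N_def by (simp add: add_divide_distrib)
    next
      case False
      then have "P l = (\<integral>\<^sup>+k. 0 \<partial>(lborel :: real measure))"
        unfolding P_def by (intro nn_integral_cong) auto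
      then show ?thesis using False by simp
    qed
    define I where "I = integral {m..1} f"
    have I: "I > 0" unfolding I_def
      by (rule bistable_integral_pos[OF f_cont \<theta> f_neg f_pos f_zeros f_int m])
    have f_cont_m: "continuous_on {m..1} f" by (rule continuous_on_subset[OF f_cont]) (use m in auto)
    have "(f has_integral I) {m..1}"
      unfolding I_def by (intro integrable_integral integrable_continuous_real f_cont_m)
    moreover have "((\<lambda>_. c) has_integral (1 - m) * c) {m..1}"
      using has_integral_const_real[of c m 1] m by simp
    ultimately have "((\<lambda>l. (f l + c) / \<gamma>) has_integral (I + (1 - m) * c) / \<gamma>) {m..1}"
      by (intro has_integral_divide has_integral_add)
    then have "((\<lambda>l. (f l + c) / \<gamma>) has_integral (I + (1 - m) * c) / \<gamma>) {m<..<1}"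
      by (simp add: has_integral_Icc_iff_Ioo)
    then have A: "(\<integral>\<^sup>+l. indicator {m<..<1} l * ennreal ((f l + c) / \<gamma>) \<partial>lborel) = ennreal ((I + (1 - m) * c) / \<gamma>)"
    proof -
      have "(\<integral>\<^sup>+l. indicator {m<..<1} l * ennreal ((f l + c) / \<gamma>) \<partial>lborel)
          = (\<integral>\<^sup>+l. ennreal (indicator {m<..<1} l * ((f l + c) / \<gamma>)) \<partial>lborel)"
        by (intro nn_integral_cong) (auto split: split_indicator)
      also have "\<dots> = ennreal ((I + (1 - m) * c) / \<gamma>)"
        by (rule nn_integral_has_integral_lebesgue) (use c(2) \<gamma> m \<open>(_ has_integral _) {m<..<1}\<close> in auto)
      finally show ?thesis .
    qed
    have B: "(\<integral>\<^sup>+l. indicator {m<..<1} l * ennreal (c / \<gamma>) \<partial>lborel) = ennreal ((1 - m) * c / \<gamma>)"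
      using m c \<gamma> by (simp add: nn_integral_multc ennreal_mult'[symmetric])
    have fm: "(\<lambda>l. indicator {m<..<1} l * ennreal ((f l + c) / \<gamma>)) \<in> borel_measurable lborel"
    proof -
      have "(\<lambda>l. indicator {m<..<1} l *\<^sub>R ((f l + c) / \<gamma>)) \<in> borel_measurable borel"
        using \<gamma> by (intro borel_measurable_continuous_on_indicator continuous_intros continuous_on_subset[OF f_cont_m]) auto
      then have "(\<lambda>l. ennreal (indicator {m<..<1} l *\<^sub>R ((f l + c) / \<gamma>))) \<in> borel_measurable lborel" by simp
      also have "(\<lambda>l. ennreal (indicator {m<..<1} l *\<^sub>R ((f l + c) / \<gamma>)))
          = (\<lambda>l. indicator {m<..<1} l * ennreal ((f l + c) / \<gamma>))"
        by (auto simp: indicator_def)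
      finally show ?thesis .
    qed
    have "(\<integral>\<^sup>+l. P l \<partial>lborel) + ennreal ((I + (1 - m) * c) / \<gamma>)
        = (\<integral>\<^sup>+l. P l + indicator {m<..<1} l * ennreal ((f l + c) / \<gamma>) \<partial>lborel)"
      unfolding A[symmetric] by (rule nn_integral_add[symmetric, OF PN(1) fm])
    also have "\<dots> \<le> (\<integral>\<^sup>+l. N l + indicator {m<..<1} l * ennreal (c / \<gamma>) \<partial>lborel)"
      by (intro nn_integral_mono level)
    also have "\<dots> = (\<integral>\<^sup>+l. P l \<partial>lborel) + ennreal ((1 - m) * c / \<gamma>)"
      unfolding B[symmetric] PN(3) by (rule nn_integral_add[OF PN(2)]) measurable
    finally have "ennreal ((I + (1 - m) * c) / \<gamma>) \<le> ennreal ((1 - m) * c / \<gamma>)"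
      using PN(4) by (auto simp: ennreal_add_left_cancel_le)
    then have "(I + (1 - m) * c) / \<gamma> \<le> (1 - m) * c / \<gamma>"
      using m c \<gamma> by (subst (asm) ennreal_le_iff) auto
    then show False using I \<gamma> by (simp add: divide_le_cancel)
  qed
  then have u1: "u x = 1" if "x \<in> - K" for x using that .
  show ?thesis
  proof
    fix x assume x: "x \<in> closure (- K)"
    show "closure_extension (- K) u x = 1"
    proof (cases "x \<in> - K")
      case True
      then show ?thesis by (simp add: closure_extension_def u1)
    next
      case False
      then have nt: "at x within - K \<noteq> bot"
        using x by (simp add: closure_def trivial_limit_within)
      have "(u \<longlongrightarrow> 1) (at x within - K)"
        by (rule tendsto_eventually) (auto simp: eventually_at_filter u1)
      then have "Lim (at x within - K) u = 1" by (rule tendsto_Lim[OF nt])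
      then show ?thesis using False by (simp add: closure_extension_def)
    qed
  qed
qed

end
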